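(* Let $F(\mathbf X,\bar{\mathbf X})$ and $G(\mathbf X,\bar{\mathbf X})$, $\mathbf X=(X_0,X_1,X_2)$, be strongly polar homogeneous mixed polynomials of polar degrees $d$ and $d'$ respectively, defining mixed projective curves $C=\{F=0\}$ and $C'=\{G=0\}$ in $\mathbb P^2$ whose mixed singularities are at worst isolated. Assume $C\cap C'\cap\{X_0=0\}=\emptyset$ and $C\cap C'=\{P_1,\dots,P_\mu\}$ is finite. Then \[ \sum_{j=1}^\mu I_{top}(C,C';P_j)=dd'. \]
   Context: A mixed polynomial $F(\mathbf X,\bar{\mathbf X})=\sum c_{\nu\mu}\mathbf X^\nu\bar{\mathbf X}^\mu$ is strongly polar homogeneous of radial degree $d_r$ and polar degree $q$ if every monomial with $c_{\nu\mu}\ne0$ satisfies $|\nu|+|\mu|=d_r$ and $|\nu|-|\mu|=q$; then its zero set is a well-defined subset of $\mathbb P^2$ (a mixed projective curve). Since $C\cap C'\subset\{X_0\ne0\}$, the local intersection numbers are computed in the affine chart $z_1=X_1/X_0$, $z_2=X_2/X_0$ using $f(\mathbf z,\bar{\mathbf z})=F(1,z_1,z_2,1,\bar z_1,\bar z_2)$ and $g(\mathbf z,\bar{\mathbf z})=G(1,z_1,z_2,1,\bar z_1,\bar z_2)$: identifying $\mathbb C^2$ with $\mathbb R^4$ via $z_j=x_j+iy_j$ (standard orientation), writing $f=f_{\mathbb R}+if_I$, $g=g_{\mathbb R}+ig_I$, $I_{top}(C,C';P)$ is the mapping degree of $\varphi/\|\varphi\|:S^3_\varepsilon(P)\to S^3$,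 $\varphi=(f_{\mathbb R},f_I,g_{\mathbb R},g_I)$, where $S^3_\varepsilon(P)$ is the boundary of a small ball around $P$ containing no other intersection point. A point is a mixed singularity of $\{f=0\}$ if the Jacobian of $(f_{\mathbb R},f_I)$ has rank $<2$ there. *)

theory Defs
  imports "HOL-Analysis.Analysis" "HOL-Homology.Homology"
begin

type_synonym midx = "nat \<times> nat \<times> nat"

fun mdeg :: "midx \<Rightarrow> nat" where
  "mdeg (a, b, c) = a + b + c"

fun mon :: "midx \<Rightarrow> complex \<times> complex \<times> complex \<Rightarrow> complex" where
  "mon (a, b, c) (x0, x1, x2) = x0 ^ a * x1 ^ b * x2 ^ c"

text \<open>A mixed polynomial is given by its coefficient function
  c nu mu (coefficient of X^nu Xbar^mu) with finite support.\<close>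
definition mixed_poly :: "(midx \<Rightarrow> midx \<Rightarrow> complex) \<Rightarrow> bool" where
  "mixed_poly c \<longleftrightarrow> finite {(nu, mu). c nu mu \<noteq> 0}"

text \<open>Evaluation with X and Xbar treated as independent variables.\<close>
definition meval :: "(midx \<Rightarrow> midx \<Rightarrow> complex) \<Rightarrow> complex \<times> complex \<times> complex
     \<Rightarrow> complex \<times> complex \<times> complex \<Rightarrow> complex" where
  "meval c X Y = (\<Sum>(nu, mu) \<in> {(nu, mu). c nu mu \<noteq> 0}. c nu mu * mon nu X * mon mu Y)"

definition conj3 :: "complex \<times> complex \<times> complex \<Rightarrow> complex \<times> complex \<times> complex" where
  "conj3 X = (case X of (x0, x1, x2) \<Rightarrow> (cnj x0, cnj x1, cnj x2))"

definition mfun :: "(midx \<Rightarrow> midx \<Rightarrow> complex) \<Rightarrow> complex \<times> complex \<times> complex \<Rightarrow> complex" where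
  "mfun c X = meval c X (conj3 X)"

definition strongly_polar_homogeneous ::
  "(midx \<Rightarrow> midx \<Rightarrow> complex) \<Rightarrow> nat \<Rightarrow> int \<Rightarrow> bool" where
  "strongly_polar_homogeneous c dr q \<longleftrightarrow> mixed_poly c \<and>
     (\<forall>nu mu. c nu mu \<noteq> 0 \<longrightarrow> mdeg nu + mdeg mu = dr \<and> int (mdeg nu) - int (mdeg mu) = q)"

definition chart_pt :: "nat \<Rightarrow> complex \<times> complex \<Rightarrow> complex \<times> complex \<times> complex" where
  "chart_pt i z = (if i = 0 then (1, fst z, snd z)
                   else if i = 1 then (fst z, 1, snd z)
                   else (fst z, snd z, 1))"

definition dehom :: "(midx \<Rightarrow> midx \<Rightarrow> complex) \<Rightarrow> nat \<Rightarrow> complex \<times> complex \<Rightarrow> complex" where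
  "dehom c i z = meval c (chart_pt i z) (chart_pt i (cnj (fst z), cnj (snd z)))"

definition mixed_singular :: "(complex \<times> complex \<Rightarrow> complex) \<Rightarrow> complex \<times> complex \<Rightarrow> bool" where
  "mixed_singular f p \<longleftrightarrow> f p = 0 \<and>
     (\<exists>D. (f has_derivative D) (at p) \<and> dim (range D) < 2)"

definition isolated_mixed_singularities :: "(midx \<Rightarrow> midx \<Rightarrow> complex) \<Rightarrow> bool" where
  "isolated_mixed_singularities c \<longleftrightarrow>
     (\<forall>i\<in>{0,1,2::nat}. \<forall>p. mixed_singular (dehom c i) p \<longrightarrow>
        (\<exists>e>0. \<forall>q. q \<in> ball p e \<and> mixed_singular (dehom c i) q \<longrightarrow> q = p))"

text \<open>The map phi = (Re f, Im f, Re g, Im g) : R^4 \<rightarrow> R^4, with z_j = x_j + i y_j,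
  coordinates ordered (x1, y1, x2, y2); vectors of R^4 are nat \<Rightarrow> real supported on {0..3}.\<close>
definition phi4 :: "(complex \<times> complex \<Rightarrow> complex) \<Rightarrow> (complex \<times> complex \<Rightarrow> complex)
     \<Rightarrow> complex \<times> complex \<Rightarrow> nat \<Rightarrow> real" where
  "phi4 f g z = (\<lambda>k. if k = 0 then Re (f z) else if k = 1 then Im (f z)
                     else if k = 2 then Re (g z) else if k = 3 then Im (g z) else 0)"

definition to_C2 :: "(nat \<Rightarrow> real) \<Rightarrow> complex \<times> complex" where
  "to_C2 u = (Complex (u 0) (u 1), Complex (u 2) (u 3))"

definition normalize4 :: "(nat \<Rightarrow> real) \<Rightarrow> nat \<Rightarrow> real" where
  "normalize4 v = (\<lambda>k. v k / sqrt (\<Sum>i\<le>3. v i ^ 2))"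

definition isol_radius :: "(complex \<times> complex \<Rightarrow> complex) \<Rightarrow> (complex \<times> complex \<Rightarrow> complex)
     \<Rightarrow> complex \<times> complex \<Rightarrow> real" where
  "isol_radius f g p = (SOME e. e > 0 \<and>
      (\<forall>q\<in>cball p e. f q = 0 \<and> g q = 0 \<longrightarrow> q = p))"

text \<open>Topological intersection number: the Brouwer degree of phi/|phi| restricted to the
  sphere of radius eps around p (identified with the unit 3-sphere by u \<mapsto> p + eps u,
  an orientation-preserving identification).\<close>
definition I_top :: "(complex \<times> complex \<Rightarrow> complex) \<Rightarrow> (complex \<times> complex \<Rightarrow> complex)
     \<Rightarrow> complex \<times> complex \<Rightarrow> int" where
  "I_top f g p = (let e = isol_radius f g p in
     Brouwer_degree2 3 (\<lambda>u. normalize4 (phi4 f g (p + scaleR e (to_C2 u)))))"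

end

theory Submission
  imports Defs
begin

text \<open>
  Both local intersection numbers and the behaviour at infinity are mapping degrees of
  \<open>\<psi> = (f, g)\<close> on 3-spheres in \<open>\<complex>\<^sup>2\<close>. In the homology of \<open>\<complex>\<^sup>2\<close> minus the zeros of \<open>\<psi>\<close>, a large
  sphere is the sum of small spheres around the zeros, so the local degrees add up to the
  degree on a large sphere. As no zero lies at infinity, the latter is the degree of
  \<open>(F(0, z), G(0, z))\<close> on the unit sphere. This map is equivariant under the circle action, with
  weights \<open>d\<close> and \<open>d'\<close> on the target. Over the two discs of \<open>\<P>\<^sup>1\<close>, any two nowhere zero
  equivariant maps are homotopic because the 3-sphere is 2-connected; hence the degree equals that of the
  model \<open>(z\<^sub>1\<^sup>d, z\<^sub>2\<^sup>d')\<close>, with conjugates for negative exponents, which is \<open>d d'\<close>.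
\<close>

section \<open>Homology of a punctured space\<close>

lemma trivial_homology_group_contractible_space:
  assumes "contractible_space X" "p \<noteq> 0"
  shows "trivial_group (homology_group p X)"
  using trivial_reduced_homology_group_contractible_space [OF assms(1), of p]
  by (simp add: assms(2) un_reduced_homology_group)

text \<open>Mayer--Vietoris for the cover of a contractible space by the complements of a point and of
  the remaining points: a class that dies in both complements is zero.\<close>

lemma homology_punctured_space_eq_one:
  fixes A :: "'a::real_normed_vector set"
  assumes "finite A" "p > 0"
    and "x \<in> carrier (homology_group p (top_of_set (- A)))"
    and "\<And>a. a \<in> A \<Longrightarrow>
      hom_induced p (top_of_set (- A)) {} (top_of_set (- {a})) {} id x
        = \<one>\<^bsub>homology_group p (top_of_set (- {a}))\<^esub>"
  shows "x = \<one>\<^bsub>homology_group p (top_of_set (- A))\<^esub>"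
  using assms(1,3,4)
proof (induction A arbitrary: x rule: finite_induct)
  case empty
  have "contractible_space (top_of_set (UNIV::'a set))"
    using contractible_UNIV contractible_space_top_of_set by blast
  then show ?case
    using empty.prems assms(2) trivial_homology_group_contractible_space
    by (fastforce simp: trivial_group_def)
next
  case (insert P B)
  let ?E = "top_of_set (UNIV::'a set)"
  let ?U = "top_of_set (- {P})" and ?V = "top_of_set (- B)" and ?W = "top_of_set (- insert P B)"
  have W: "- insert P B = - B - {P}" by auto
  have subU: "subtopology ?U (- B - {P}) = ?W"
    by (auto simp: subtopology_subtopology W intro: arg_cong)
  have subE: "subtopology ?E (- B) = ?V"
    by (simp add: subtopology_subtopology)
  have cont: "continuous_map ?W ?V id" "continuous_map ?W ?U id"
    by auto
  \<comment> \<open>The map to the complement of any a in B factors through the complement of B, so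
    the induction hypothesis applies to the image of x there.\<close>
  have x1: "hom_induced p ?W {} ?V {} id x = \<one>\<^bsub>homology_group p ?V\<^esub>"
  proof (rule insert.IH)
    show "hom_induced p ?W {} ?V {} id x \<in> carrier (homology_group p ?V)"
      by (simp add: hom_induced_carrier)
    fix a assume "a \<in> B"
    then have "continuous_map ?V (top_of_set (- {a})) id"
      by auto
    then have "hom_induced p ?V {} (top_of_set (- {a})) {} id (hom_induced p ?W {} ?V {} id x)
      = hom_induced p ?W {} (top_of_set (- {a})) {} id x"
      using hom_induced_compose' [OF cont(1), of "{}" "{}" "top_of_set (- {a})" id "{}" p x]
      by simp
    then show "hom_induced p ?V {} (top_of_set (- {a})) {} id (hom_induced p ?W {} ?V {} id x)
      = \<one>\<^bsub>homology_group p (top_of_set (- {a}))\<^esub>"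
      using insert.prems(2) \<open>a \<in> B\<close> by simp
  qed
  \<comment> \<open>Exactness for the pair of complements of {P} and of \<open>insert P B\<close>: a
    class dying in the complement of P is the boundary of a relative class y.\<close>
  have "exact_seq ([homology_group p ?U, homology_group p ?W, relative_homology_group (p+1) ?U (- B - {P})],
              [hom_induced p ?W {} ?U {} id, hom_boundary (p+1) ?U (- B - {P})])"
    using homology_exactness_axiom_2 [of "p+1" ?U "- B - {P}"] by (simp add: subU)
  then have ker: "kernel (homology_group p ?W) (homology_group p ?U) (hom_induced p ?W {} ?U {} id)
     = hom_boundary (p+1) ?U (- B - {P}) ` carrier (relative_homology_group (p+1) ?U (- B - {P}))"
    by (simp only: exact_seq_cons_iff)
  have "x \<in> kernel (homology_group p ?W) (homology_group p ?U) (hom_induced p ?W {} ?U {} id)"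
    using insert.prems(1) insert.prems(2) [of P] by (simp add: kernel_def id_def)
  then obtain y where y: "y \<in> carrier (relative_homology_group (p+1) ?U (- B - {P}))"
      and xy: "x = hom_boundary (p+1) ?U (- B - {P}) y"
    unfolding ker by blast
  define exc where "exc = hom_induced (p+1) ?U (- B - {P}) ?E (- B) id"
  \<comment> \<open>The point P is excised from the pair of the whole space and the complement of B.
    This is allowed because P lies in the open set \<open>- B\<close>.\<close>
  have "open (- B)"
    using insert.hyps finite_imp_closed by blast
  then have "euclidean closure_of {P} \<subseteq> euclidean interior_of (- B)"
    using insert.hyps by (simp add: interior_open)
  from homology_excision_axiom [OF this, of UNIV "p+1"]
  have exc: "exc \<in> iso (relative_homology_group (p+1) ?U (- B - {P})) (relative_homology_group (p+1) ?E (- B))"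
    by (simp add: exc_def Compl_eq_Diff_UNIV)
  \<comment> \<open>By naturality the boundary of \<open>exc y\<close> is the image of x in the
    complement of B, which is trivial. So \<open>exc y\<close> comes from the homology of the
    contractible whole space and vanishes; injectivity of excision then kills y and hence x.\<close>
  have "hom_boundary (p+1) ?E (- B) (exc y) = hom_induced p ?W {} ?V {} id x"
    using naturality_hom_induced [of ?U ?E id "- B - {P}" "- B" "p+1"]
    unfolding fun_eq_iff by (simp add: exc_def xy subU)
  moreover have excy: "exc y \<in> carrier (relative_homology_group (p+1) ?E (- B))"
    by (simp add: exc_def hom_induced_carrier)
  ultimately have "exc y \<in> kernel (relative_homology_group (p+1) ?E (- B)) (homology_group p ?V) (hom_boundary (p+1) ?E (- B))"
    using x1 by (simp add: kernel_def)
  moreover have "kernel (relative_homology_group (p+1) ?E (- B)) (homology_group p ?V) (hom_boundary (p+1) ?E (- B))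
      = hom_induced (p+1) ?E {} ?E (- B) id ` carrier (homology_group (p+1) ?E)"
    using homology_exactness_axiom_1 [of "p+1" ?E "- B"]
    by (simp only: exact_seq_cons_iff subE) simp
  moreover have "contractible_space ?E"
    using contractible_UNIV contractible_space_top_of_set by blast
  then have "carrier (homology_group (p+1) ?E) = {\<one>\<^bsub>homology_group (p+1) ?E\<^esub>}"
    using trivial_homology_group_contractible_space [of ?E "p+1"] assms(2)
    by (simp add: trivial_group_def)
  ultimately have "exc y = hom_induced (p+1) ?E {} ?E (- B) id \<one>\<^bsub>homology_group (p+1) ?E\<^esub>"
    by auto
  also have "\<dots> = \<one>\<^bsub>relative_homology_group (p+1) ?E (- B)\<^esub>"
    using hom_induced_hom hom_one by (metis group_relative_homology_group)
  also have "\<dots> = exc \<one>\<^bsub>relative_homology_group (p+1) ?U (- B - {P})\<^esub>"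
    unfolding exc_def using hom_induced_hom hom_one by (metis group_relative_homology_group)
  finally have "y = \<one>\<^bsub>relative_homology_group (p+1) ?U (- B - {P})\<^esub>"
    using exc y by (auto simp: iso_def bij_betw_def inj_on_def group.is_monoid)
  then show ?case
    unfolding xy subU [symmetric]
    by (metis (no_types, lifting) add_diff_cancel_right' group_relative_homology_group hom_boundary_hom hom_one subU)
qed

section \<open>Degrees on spheres in complex 2-space\<close>

lemma hom_finprod:
  assumes "comm_group G" "comm_group H" "h \<in> hom G H" "f \<in> A \<rightarrow> carrier G"
  shows "h (finprod G f A) = finprod H (\<lambda>x. h (f x)) A"
proof -
  interpret G: comm_group G by fact
  interpret H: comm_group H by fact
  have h: "\<And>x. x \<in> carrier G \<Longrightarrow> h x \<in> carrier H" "h \<one>\<^bsub>G\<^esub> = \<one>\<^bsub>H\<^esub>"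
    using assms(3) by (auto simp: hom_def intro: hom_one)
  show ?thesis
  proof (cases "finite A")
    case True
    then show ?thesis
      using assms(4)
    proof (induction A rule: finite_induct)
      case empty
      then show ?case by (simp add: h)
    next
      case (insert a B)
      then have "f a \<in> carrier G" "f \<in> B \<rightarrow> carrier G"
        by auto
      with insert show ?case
        using assms(3) h by (subst H.finprod_insert) (auto simp: hom_def Pi_iff)
    qed
  qed (simp add: h)
qed

lemma (in comm_group) finprod_int_pow_sum:
  fixes f :: "'c \<Rightarrow> int"
  assumes "finite A" "a \<in> carrier G"
  shows "finprod G (\<lambda>x. a [^] f x) A = a [^] sum f A"
  using assms(1) by (induction A rule: finite_induct) (auto simp: assms(2) int_pow_mult)

text \<open>The real coordinates of a point, inverse to \<open>to_C2\<close>: the two projections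
  are fed to \<open>phi4\<close> as f and g.\<close>

definition of_C2 :: "complex \<times> complex \<Rightarrow> nat \<Rightarrow> real" where
  "of_C2 = phi4 fst snd"

text \<open>On a normed space \<open>sgn\<close> is radial projection, so this is the mapping degree
  of \<psi>/|\<psi>| on the unit sphere of C^2, transported to the coordinate sphere. It has this
  meaning for \<psi> continuous and nowhere zero on that sphere.\<close>

definition sphere_degree :: "(complex \<times> complex \<Rightarrow> complex \<times> complex) \<Rightarrow> int" where
  "sphere_degree \<psi> = Brouwer_degree2 3 (\<lambda>u. of_C2 (sgn (\<psi> (to_C2 u))))"

section \<open>The coordinate 3-sphere and the unit sphere of C^2\<close>

lemma nsphere_top_of_set:
  "nsphere n = top_of_set {x. (\<Sum>i\<le>n. x i ^ 2) = 1 \<and> (\<forall>i>n. x i = 0)}"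
  by (simp add: nsphere euclidean_product_topology)

lemma to_C2_of_C2 [simp]: "to_C2 (of_C2 z) = z"
  by (simp add: to_C2_def of_C2_def phi4_def)

lemma norm_to_C2: "norm (to_C2 u) = sqrt (\<Sum>i\<le>3. u i ^ 2)"
proof -
  have "{..3::nat} = {0, 1, 2, 3}"
    by auto
  then show ?thesis
    by (simp add: to_C2_def norm_Pair norm_complex_def)
qed

lemma of_C2_to_C2: "u \<in> topspace (nsphere 3) \<Longrightarrow> of_C2 (to_C2 u) = u"
proof
  fix k :: nat
  assume u: "u \<in> topspace (nsphere 3)"
  have "k = 0 \<or> k = 1 \<or> k = 2 \<or> k = 3 \<or> k > 3"
    by linarith
  with u show "of_C2 (to_C2 u) k = u k"
    by (auto simp: nsphere_top_of_set to_C2_def of_C2_def phi4_def)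
qed

lemma norm_to_C2_nsphere: "u \<in> topspace (nsphere 3) \<Longrightarrow> norm (to_C2 u) = 1"
  by (simp add: norm_to_C2 nsphere_top_of_set)

lemma continuous_on_to_C2: "continuous_on S to_C2"
proof -
  have "continuous_on S (\<lambda>u::nat \<Rightarrow> real. u i)" for i
    by (rule continuous_on_subset [OF continuous_on_product_coordinates subset_UNIV])
  then show ?thesis
    unfolding to_C2_def Complex_eq
    by (intro continuous_on_Pair continuous_on_add continuous_on_mult_left continuous_on_of_real)
qed

lemma continuous_on_of_C2: "continuous_on S of_C2"
  unfolding of_C2_def phi4_def
  apply (rule continuous_on_coordinatewise_then_product)
  subgoal for i by (cases "i = 0"; cases "i = 1"; cases "i = 2"; cases "i = 3") (auto intro!: continuous_intros)
  done

lemma of_C2_nsphere: "norm z = 1 \<Longrightarrow> of_C2 z \<in> topspace (nsphere 3)"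
proof -
  assume "norm z = 1"
  moreover have "norm z = sqrt (\<Sum>i\<le>3. of_C2 z i ^ 2)"
    by (metis norm_to_C2 to_C2_of_C2)
  ultimately show ?thesis
    by (auto simp: nsphere_top_of_set of_C2_def phi4_def)
qed

lemma continuous_map_to_C2: "continuous_map (nsphere 3) (top_of_set (sphere 0 1)) to_C2"
  using norm_to_C2_nsphere by (auto simp: nsphere_top_of_set continuous_on_to_C2)

lemma continuous_map_Pair_to_C2:
  "continuous_map (prod_topology (top_of_set T) (nsphere 3))
     (prod_topology (top_of_set T) (top_of_set (sphere 0 1))) (\<lambda>(t, u). (t, to_C2 u))"
  using norm_to_C2_nsphere
  by (auto simp: nsphere_top_of_set prod_topology_subtopology_eu case_prod_unfold
      intro!: continuous_on_Pair continuous_on_fst continuous_on_id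
        continuous_on_compose2 [OF continuous_on_to_C2 [of UNIV] continuous_on_snd])

lemma continuous_map_of_C2: "continuous_map (top_of_set (sphere 0 1)) (nsphere 3) of_C2"
  using of_C2_nsphere by (auto simp: nsphere_top_of_set continuous_on_of_C2)

lemma continuous_map_sphere_degree:
  assumes "continuous_map X (top_of_set (- {0})) \<psi>"
  shows "continuous_map X (nsphere 3) (\<lambda>x. of_C2 (sgn (\<psi> x)))"
proof -
  have "continuous_map (top_of_set (- {0})) (top_of_set (sphere 0 1)) (sgn :: complex \<times> complex \<Rightarrow> _)"
    by (auto simp: norm_sgn sgn_div_norm intro!: continuous_intros)
  from continuous_map_compose [OF continuous_map_compose [OF assms this] continuous_map_of_C2]
  show ?thesis by (simp add: comp_def)
qed

lemma continuous_map_sphere_degree_to_C2: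
  assumes "continuous_on (sphere 0 1) \<psi>" "\<And>z. norm z = 1 \<Longrightarrow> \<psi> z \<noteq> 0"
  shows "continuous_map (nsphere 3) (nsphere 3) (\<lambda>u. of_C2 (sgn (\<psi> (to_C2 u))))"
proof -
  have "continuous_map (top_of_set (sphere 0 1)) (top_of_set (- {0})) \<psi>"
    using assms by auto
  from continuous_map_compose [OF continuous_map_to_C2 this] show ?thesis
    using continuous_map_sphere_degree [of "nsphere 3" "\<psi> \<circ> to_C2"] by simp
qed

lemma sphere_degree_cong:
  assumes "\<And>z. norm z = 1 \<Longrightarrow> \<psi> z = \<xi> z"
  shows "sphere_degree \<psi> = sphere_degree \<xi>"
  unfolding sphere_degree_def
  by (rule Brouwer_degree2_eq) (simp add: assms norm_to_C2_nsphere)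

text \<open>The homotopy may leave the sphere as long as it avoids 0, since radial projection brings
  it back.\<close>

lemma sphere_degree_homotopic:
  assumes "continuous_on ({0..1} \<times> sphere 0 1) h"
    and "\<And>t z. 0 \<le> t \<Longrightarrow> t \<le> 1 \<Longrightarrow> norm z = 1 \<Longrightarrow> h (t, z) \<noteq> 0"
    and "\<And>z. norm z = 1 \<Longrightarrow> h (0::real, z) = \<psi> z" "\<And>z. norm z = 1 \<Longrightarrow> h (1, z) = \<xi> z"
  shows "sphere_degree \<psi> = sphere_degree \<xi>"
proof -
  have "continuous_map (prod_topology (top_of_set {0..1}) (top_of_set (sphere 0 1))) (top_of_set (- {0})) h"
    using assms(1,2) by (auto simp: prod_topology_subtopology_eu)
  from continuous_map_compose [OF continuous_map_Pair_to_C2 this]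
  have "continuous_map (prod_topology (top_of_set {0..1}) (nsphere 3)) (nsphere 3)
     (\<lambda>x. of_C2 (sgn (h (case x of (t, u) \<Rightarrow> (t, to_C2 u)))))"
    unfolding comp_def by (rule continuous_map_sphere_degree)
  then have "homotopic_with (\<lambda>x. True) (nsphere 3) (nsphere 3)
      (\<lambda>u. of_C2 (sgn (h (0, to_C2 u)))) (\<lambda>u. of_C2 (sgn (h (1, to_C2 u))))"
    unfolding homotopic_with_def by (intro exI conjI) auto
  then have "sphere_degree (\<lambda>z. h (0, z)) = sphere_degree (\<lambda>z. h (1, z))"
    unfolding sphere_degree_def by (rule Brouwer_degree2_homotopic)
  moreover have "sphere_degree (\<lambda>z. h (0, z)) = sphere_degree \<psi>"
    by (rule sphere_degree_cong) (rule assms(3))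
  moreover have "sphere_degree (\<lambda>z. h (1, z)) = sphere_degree \<xi>"
    by (rule sphere_degree_cong) (rule assms(4))
  ultimately show ?thesis
    by simp
qed

section \<open>Large spheres as sums of small spheres, in homology and in degree\<close>

lemma continuous_map_nsphere_C2:
  assumes "sphere c \<rho> \<subseteq> S" "\<rho> \<ge> 0"
  shows "continuous_map (nsphere 3) (top_of_set S) (\<lambda>u. c + \<rho> *\<^sub>R to_C2 u)"
proof -
  have "continuous_map (top_of_set (sphere 0 1)) (top_of_set S) (\<lambda>z. c + \<rho> *\<^sub>R z)"
  proof -
    have "c + \<rho> *\<^sub>R z \<in> S" if "z \<in> sphere 0 1" for z
      using assms that by (intro subsetD [OF assms(1)]) (simp add: dist_norm)
    then show ?thesis
      by (auto intro!: continuous_intros simp del: split_paired_All)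
  qed
  from continuous_map_compose [OF continuous_map_to_C2 this] show ?thesis
    by (simp add: comp_def)
qed

text \<open>The induced map factors through the homology of Y, which is trivial in nonzero
  degree.\<close>

lemma hom_induced_nullhomotopic_eq_one:
  assumes "continuous_map X Y f" "continuous_map Y Z g" "contractible_space Y" "p \<noteq> 0"
  shows "hom_induced p X {} Z {} (g \<circ> f) x = \<one>\<^bsub>homology_group p Z\<^esub>"
proof -
  have "hom_induced p X {} Y {} f x \<in> carrier (homology_group p Y)"
    by (rule hom_induced_carrier)
  then have "hom_induced p X {} Y {} f x = \<one>\<^bsub>homology_group p Y\<^esub>"
    using trivial_homology_group_contractible_space [OF assms(3,4)] by (simp add: trivial_group_def)
  moreover have "hom_induced p X {} Z {} (g \<circ> f) x = hom_induced p Y {} Z {} g (hom_induced p X {} Y {} f x)"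
    using hom_induced_compose' [OF assms(1) _ assms(2), of "{}" "{}" "{}"] by simp
  moreover have "hom_induced p Y {} Z {} g \<one>\<^bsub>homology_group p Y\<^esub> = \<one>\<^bsub>homology_group p Z\<^esub>"
    by (meson group_relative_homology_group hom_induced_hom hom_one)
  ultimately show ?thesis
    by simp
qed

lemma sphere_subset_Compl:
  fixes P :: "'a::metric_space"
  assumes "0 < \<rho>" "cball P \<rho> \<inter> A = {P}"
  shows "sphere P \<rho> \<subseteq> - A"
proof
  fix x assume x: "x \<in> sphere P \<rho>"
  then have "x \<in> cball P \<rho>" "x \<noteq> P"
    using assms(1) by auto
  then show "x \<in> - A"
    using assms(2) by blast
qed

text \<open>It suffices to compare both sides in the complement of each single point Q of A. There
  the small spheres around the other points bound balls and vanish, while the small sphere around Q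
  can be moved to the large one.\<close>

lemma homology_large_sphere_eq_finprod:
  fixes A :: "(complex \<times> complex) set"
  assumes "finite A" "p > 0"
    and A: "A \<subseteq> ball 0 R"
    and r: "\<And>P. P \<in> A \<Longrightarrow> r P > 0" "\<And>P. P \<in> A \<Longrightarrow> cball P (r P) \<inter> A = {P}"
  shows "hom_induced p (nsphere 3) {} (top_of_set (- A)) {} (\<lambda>u. R *\<^sub>R to_C2 u) a
    = finprod (homology_group p (top_of_set (- A)))
        (\<lambda>P. hom_induced p (nsphere 3) {} (top_of_set (- A)) {} (\<lambda>u. P + r P *\<^sub>R to_C2 u) a) A"
proof (cases "A = {}")
  \<comment> \<open>Positivity of R is derived from a point of A, so empty A is separate; its
    complement is contractible and all classes are trivial.\<close>
  case True
  have "contractible_space (top_of_set (- A))"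
    unfolding True Compl_empty_eq contractible_space_top_of_set by (rule contractible_UNIV)
  then have "trivial_group (homology_group p (top_of_set (- A)))"
    using assms(2) by (simp add: trivial_homology_group_contractible_space)
  moreover have "hom_induced p (nsphere 3) {} (top_of_set (- A)) {} (\<lambda>u. R *\<^sub>R to_C2 u) a
      \<in> carrier (homology_group p (top_of_set (- A)))"
    by (rule hom_induced_carrier)
  ultimately show ?thesis
    unfolding True comm_monoid.finprod_empty [OF comm_group.axioms(1) [OF abelian_homology_group]]
    by (simp add: trivial_group_def del: Compl_empty_eq)
next
  case False
  then obtain P where "P \<in> A" by blast
  with A have "norm P < R" by auto
  then have R: "R > 0"
    using norm_ge_zero [of P] by linarith
  let ?X = "top_of_set (- A)" and ?N = "nsphere 3"
  let ?H = "homology_group p ?X"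
  define i where "i Y c \<rho> = hom_induced p ?N {} (Y::(complex \<times> complex) topology) {} (\<lambda>u. c + \<rho> *\<^sub>R to_C2 u) a" for Y c \<rho>
  have icar: "i Y c \<rho> \<in> carrier (homology_group p Y)" for Y c \<rho>
    by (simp add: i_def hom_induced_carrier)
  interpret H: comm_group ?H by (rule abelian_homology_group)
  let ?fp = "finprod ?H (\<lambda>P. i ?X P (r P)) A"
  have fpcar: "?fp \<in> carrier ?H"
    by (rule H.finprod_closed) (auto simp: icar)
  have sub: "sphere 0 R \<subseteq> - A"
    using A by auto
  have sub': "sphere P (r P) \<subseteq> - A" if "P \<in> A" for P
    using sphere_subset_Compl [OF r(1) r(2)] that by blast
  \<comment> \<open>The quotient of the two sides is shown to die in the complement of every Q in
    A.\<close>
  have "i ?X 0 R \<otimes>\<^bsub>?H\<^esub> inv\<^bsub>?H\<^esub> ?fp = \<one>\<^bsub>?H\<^esub>"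
  proof (rule homology_punctured_space_eq_one [OF assms(1,2)])
    show "i ?X 0 R \<otimes>\<^bsub>?H\<^esub> inv\<^bsub>?H\<^esub> ?fp \<in> carrier ?H"
      by (simp add: icar fpcar)
    fix Q assume Q: "Q \<in> A"
    let ?Y = "top_of_set (- {Q})"
    let ?K = "homology_group p ?Y"
    interpret K: comm_group ?K by (rule abelian_homology_group)
    define j where "j = hom_induced p ?X {} ?Y {} id"
    have j: "j \<in> hom ?H ?K"
      by (simp add: j_def hom_induced_hom)
    then interpret j: group_hom ?H ?K j
      by (simp add: group_hom_axioms_def group_hom_def)
    have ji: "j (i ?X c \<rho>) = i ?Y c \<rho>" if "sphere c \<rho> \<subseteq> - A" "\<rho> \<ge> 0" for c \<rho>
    proof -
      have "continuous_map ?X ?Y id"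
        using Q by auto
      from hom_induced_compose' [OF continuous_map_nsphere_C2 [OF that] _ this, of "{}" "{}" "{}"]
      show ?thesis by (simp add: j_def i_def comp_def id_def)
    qed
    have "j ?fp = finprod ?K (\<lambda>P. i ?Y P (r P)) A"
    proof -
      have "j ?fp = finprod ?K (\<lambda>P. j (i ?X P (r P))) A"
        by (rule hom_finprod) (auto simp: j icar abelian_homology_group)
      also have "\<dots> = finprod ?K (\<lambda>P. i ?Y P (r P)) A"
        by (rule K.finprod_cong') (simp_all add: icar ji sub' r(1) less_imp_le)
      finally show ?thesis .
    qed
    also have "\<dots> = finprod ?K (\<lambda>P. if Q = P then i ?Y P (r P) else \<one>\<^bsub>?K\<^esub>) A"
    proof (rule K.finprod_cong')
      fix P assume P: "P \<in> A"
      show "i ?Y P (r P) = (if Q = P then i ?Y P (r P) else \<one>\<^bsub>?K\<^esub>)"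
      proof (cases "Q = P")
        case False
        \<comment> \<open>For P other than Q the sphere map factors through the closed ball around
          P, which is contractible and misses Q.\<close>
        have "continuous_map ?N (top_of_set (cball P (r P))) (\<lambda>u. P + r P *\<^sub>R to_C2 u)"
          using r(1) [OF P] by (intro continuous_map_nsphere_C2) auto
        moreover have "cball P (r P) \<subseteq> - {Q}"
          using r(2) [OF P] False Q by blast
        then have "continuous_map (top_of_set (cball P (r P))) ?Y id"
          by (simp add: id_def subset_eq)
        moreover have "contractible_space (top_of_set (cball P (r P)))"
          by (simp add: convex_imp_contractible)
        ultimately have "hom_induced p ?N {} ?Y {} (id \<circ> (\<lambda>u. P + r P *\<^sub>R to_C2 u)) a = \<one>\<^bsub>?K\<^esub>"
          using assms(2) by (intro hom_induced_nullhomotopic_eq_one) auto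
        with False show ?thesis
          by (simp add: i_def)
      qed auto
    qed (auto simp: icar)
    also have "\<dots> = i ?Y Q (r Q)"
      by (rule K.finprod_singleton) (auto simp: Q assms(1) icar)
    also have "\<dots> = i ?Y 0 R"
    proof -
      \<comment> \<open>The straight-line homotopy between the two sphere maps. Meeting Q would give
        \<open>(1 - t) * r Q + t * R = t * norm Q\<close>, but the left side is larger because
        \<open>r Q > 0\<close> and \<open>norm Q < R\<close>.\<close>
      define h where "h = (\<lambda>(t, z). (1 - t) *\<^sub>R (Q + r Q *\<^sub>R z) + t *\<^sub>R (R *\<^sub>R (z::complex \<times> complex)))"
      have "h (t, z) \<noteq> Q" if "0 \<le> t" "t \<le> 1" "norm z = 1" for t z
      proof
        assume "h (t, z) = Q"
        then have eq: "((1 - t) * r Q + t * R) *\<^sub>R z = t *\<^sub>R Q"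
          by (simp add: h_def algebra_simps)
        have "r Q > 0" "norm Q < R"
          using r Q A by auto
        have ge: "(1 - t) * r Q + t * R \<ge> 0"
          using that R \<open>r Q > 0\<close> by simp
        have "(1 - t) * r Q + t * R = t * norm Q"
          using arg_cong [OF eq, of norm] that ge by simp
        moreover have "(1 - t) * r Q + t * R > t * norm Q"
        proof (cases "t = 0")
          case True
          then show ?thesis using \<open>r Q > 0\<close> by simp
        next
          case False
          then have "t * norm Q < t * R"
            using that \<open>norm Q < R\<close> by simp
          moreover have "(1 - t) * r Q \<ge> 0"
            using that \<open>r Q > 0\<close> by simp
          ultimately show ?thesis by linarith
        qed
        ultimately show False by simp
      qed
      then have "continuous_map (prod_topology (top_of_set {0..1}) (top_of_set (sphere 0 1))) ?Y h"
        unfolding h_def prod_topology_subtopology_eu case_prod_unfold continuous_map_subtopology_eu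
        by (intro conjI continuous_intros) auto
      from continuous_map_compose [OF continuous_map_Pair_to_C2 this]
      have "continuous_map (prod_topology (top_of_set {0..1}) ?N) ?Y
          (\<lambda>x. h (case x of (t, u) \<Rightarrow> (t, to_C2 u)))"
        by (simp add: comp_def)
      then have "homotopic_with (\<lambda>x. True) ?N ?Y (\<lambda>u. Q + r Q *\<^sub>R to_C2 u) (\<lambda>u. 0 + R *\<^sub>R to_C2 u)"
        unfolding homotopic_with_def by (intro exI conjI) (auto simp: h_def)
      then show ?thesis
        unfolding i_def by (rule fun_cong [OF homology_homotopy_empty])
    qed
    finally have jfp: "j ?fp = i ?Y 0 R" .
    have "j (i ?X 0 R \<otimes>\<^bsub>?H\<^esub> inv\<^bsub>?H\<^esub> ?fp) = i ?Y 0 R \<otimes>\<^bsub>?K\<^esub> inv\<^bsub>?K\<^esub> (i ?Y 0 R)"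
      using sub R by (simp add: icar fpcar jfp ji)
    then show "hom_induced p ?X {} ?Y {} id (i ?X 0 R \<otimes>\<^bsub>?H\<^esub> inv\<^bsub>?H\<^esub> ?fp) = \<one>\<^bsub>?K\<^esub>"
      by (simp add: j_def icar)
  qed
  then have "i ?X 0 R = ?fp"
    using H.inv_equality [of "i ?X 0 R" "inv\<^bsub>?H\<^esub> ?fp"] by (simp add: icar fpcar)
  then show ?thesis
    by (simp add: i_def)
qed

text \<open>The map \<psi>/|\<psi>|, defined off the zeros, sends the homology relation between the
  spheres to a relation between powers of a generator of the third homology of the 3-sphere. The
  exponents are the degrees.\<close>

theorem sphere_degree_eq_sum:
  fixes \<psi> :: "complex \<times> complex \<Rightarrow> complex \<times> complex"
  assumes cont: "continuous_on UNIV \<psi>" and fin: "finite {z. \<psi> z = 0}"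
    and R: "\<And>z. \<psi> z = 0 \<Longrightarrow> norm z < R"
    and r: "\<And>P. \<psi> P = 0 \<Longrightarrow> r P > 0"
      "\<And>P Q. \<psi> P = 0 \<Longrightarrow> \<psi> Q = 0 \<Longrightarrow> dist P Q \<le> r P \<Longrightarrow> Q = P"
    and "R > 0"
  shows "sphere_degree (\<lambda>z. \<psi> (R *\<^sub>R z)) = (\<Sum>P | \<psi> P = 0. sphere_degree (\<lambda>z. \<psi> (P + r P *\<^sub>R z)))"
proof -
  define A where "A = {z. \<psi> z = 0}"
  let ?p = "int 3"
  let ?X = "top_of_set (- A)" and ?N = "nsphere 3"
  let ?G = "reduced_homology_group ?p ?N" and ?H = "homology_group ?p ?X"
  have Geq: "homology_group ?p ?N = ?G"
    by (simp add: un_reduced_homology_group)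
  interpret G: comm_group ?G
    using abelian_homology_group [of ?p ?N] by (simp only: Geq)
  interpret H: comm_group ?H by (rule abelian_homology_group)
  obtain a where a: "a \<in> carrier ?G" and aeq: "subgroup_generated ?G {a} = ?G"
    using cyclic_reduced_homology_group_nsphere [of ?p 3] by (auto simp: cyclic_group_def)
  define \<Psi> where "\<Psi> z = of_C2 (sgn (\<psi> z))" for z
  have "continuous_map ?X (top_of_set (- {0})) \<psi>"
    using continuous_on_subset [OF cont] by (auto simp: A_def)
  then have \<Psi>: "continuous_map ?X ?N \<Psi>"
    unfolding \<Psi>_def by (rule continuous_map_sphere_degree)
  define h where "h = hom_induced ?p ?X {} ?N {} \<Psi>"
  have h: "h \<in> hom ?H ?G"
    unfolding h_def Geq [symmetric] by (rule hom_induced_hom)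
  define i where "i c \<rho> = hom_induced ?p ?N {} ?X {} (\<lambda>u. c + \<rho> *\<^sub>R to_C2 u) a" for c \<rho>
  have icar: "i c \<rho> \<in> carrier ?H" for c \<rho>
    unfolding i_def by (rule hom_induced_carrier)
  \<comment> \<open>Composing a sphere inclusion with \<psi>/|\<psi>| gives a self-map of the
    3-sphere, which acts on the generator a by its degree.\<close>
  have hi: "h (i c \<rho>) = a [^]\<^bsub>?G\<^esub> sphere_degree (\<lambda>z. \<psi> (c + \<rho> *\<^sub>R z))"
    if "sphere c \<rho> \<subseteq> - A" "\<rho> \<ge> 0" for c \<rho>
  proof -
    have "h (i c \<rho>) = hom_induced ?p ?N {} ?N {} (\<Psi> \<circ> (\<lambda>u. c + \<rho> *\<^sub>R to_C2 u)) a"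
      unfolding h_def i_def
      by (rule hom_induced_compose' [OF continuous_map_nsphere_C2 [OF that] _ \<Psi>]) auto
    also have "\<dots> = a [^]\<^bsub>?G\<^esub> sphere_degree (\<lambda>z. \<psi> (c + \<rho> *\<^sub>R z))"
      unfolding sphere_degree_def \<Psi>_def comp_def by (rule Brouwer_degree2 [OF a])
    finally show ?thesis .
  qed
  have A: "finite A" "A \<subseteq> ball 0 R" "\<And>P. P \<in> A \<Longrightarrow> 0 < r P"
    using fin R r(1) by (auto simp: A_def)
  have cball: "cball P (r P) \<inter> A = {P}" if "P \<in> A" for P
  proof (intro equalityI subsetI)
    fix Q assume "Q \<in> cball P (r P) \<inter> A"
    then show "Q \<in> {P}"
      using r(2) [of P Q] that by (simp add: A_def)
  qed (use A(3) [OF that] that in \<open>simp add: less_imp_le\<close>)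
  have sub: "sphere 0 R \<subseteq> - A"
    using A(2) by auto
  have sub': "sphere P (r P) \<subseteq> - A" if "P \<in> A" for P
    using sphere_subset_Compl [OF A(3) cball] that by blast
  have "i 0 R = finprod ?H (\<lambda>P. i P (r P)) A"
    unfolding i_def
    using homology_large_sphere_eq_finprod [OF A(1) _ A(2,3) cball, of ?p a] by simp
  then have "h (i 0 R) = finprod ?G (\<lambda>P. h (i P (r P))) A"
    using hom_finprod [OF H.comm_group_axioms G.comm_group_axioms h, of "\<lambda>P. i P (r P)" A] icar by auto
  also have "\<dots> = finprod ?G (\<lambda>P. a [^]\<^bsub>?G\<^esub> sphere_degree (\<lambda>z. \<psi> (P + r P *\<^sub>R z))) A"
  proof (rule G.finprod_cong')
    show "(\<lambda>P. a [^]\<^bsub>?G\<^esub> sphere_degree (\<lambda>z. \<psi> (P + r P *\<^sub>R z))) \<in> A \<rightarrow> carrier ?G"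
      using G.int_pow_closed [OF a] by blast
  qed (simp_all add: hi sub' A(3) less_imp_le)
  also have "\<dots> = a [^]\<^bsub>?G\<^esub> (\<Sum>P\<in>A. sphere_degree (\<lambda>z. \<psi> (P + r P *\<^sub>R z)))"
    using A(1) a by (rule G.finprod_int_pow_sum)
  also have "h (i 0 R) = a [^]\<^bsub>?G\<^esub> sphere_degree (\<lambda>z. \<psi> (R *\<^sub>R z))"
    using hi [of 0 R] sub \<open>R > 0\<close> by simp
  finally have "a [^]\<^bsub>?G\<^esub> sphere_degree (\<lambda>z. \<psi> (R *\<^sub>R z))
     = a [^]\<^bsub>?G\<^esub> (\<Sum>P\<in>A. sphere_degree (\<lambda>z. \<psi> (P + r P *\<^sub>R z)))" .
  \<comment> \<open>Order 0 encodes infinite order: a generates a group isomorphic to the integers,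
    so equal powers of a have equal exponents.\<close>
  moreover have "G.ord a = 0"
    using iso_finite [OF reduced_homology_group_nsphere(1), of 3] G.infinite_cyclic_subgroup_order [OF a] aeq
    by simp
  ultimately show ?thesis
    using G.int_pow_eq [OF a] by (simp add: A_def)
qed

section \<open>Circle-equivariant maps\<close>

text \<open>K is enclosed in a box, regarded as a complex with one cell. Its dimension is at most
  that of the target sphere, so the obstructions to extension lie in vanishing homotopy
  groups.\<close>

lemma extend_map_to_sphere_lowdim:
  fixes f :: "'a::euclidean_space \<Rightarrow> 'b::euclidean_space"
  assumes dim: "DIM('a) < DIM('b)" and L: "closed L" "L \<subseteq> K" and K: "bounded K"
    and f: "continuous_on L f" "f \<in> L \<rightarrow> sphere 0 1"
  obtains g where "continuous_on K g" "g \<in> K \<rightarrow> sphere 0 1" "\<And>x. x \<in> L \<Longrightarrow> g x = f x"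
proof -
  obtain a where a: "K \<subseteq> cbox (- a) a"
    using bounded_subset_cbox_symmetric [OF K] by blast
  have front: "rel_frontier (cball (0::'b) 1) = sphere 0 1"
    by (simp add: rel_frontier_cball)
  obtain g where g: "continuous_on (\<Union>{cbox (- a) a}) g"
     "g \<in> (\<Union>{cbox (- a) a}) \<rightarrow> rel_frontier (cball 0 1)" "\<And>x. x \<in> L \<Longrightarrow> g x = f x"
  proof (rule extend_map_cell_complex_to_sphere [of "{cbox (- a) a}" L "cball (0::'b) 1" f])
    fix X assume "X \<in> {cbox (- a) a}"
    have "aff_dim X \<le> int DIM('a)"
      by (rule aff_dim_le_DIM)
    also have "\<dots> < aff_dim (cball (0::'b) 1)"
      using dim by (simp add: aff_dim_cball)
    finally show "aff_dim X < aff_dim (cball (0::'b) 1)" .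
  qed (use L a f in \<open>auto simp: front polytope_interval face_of_refl\<close>)
  show thesis
  proof
    show "continuous_on K g"
      using g(1) a continuous_on_subset by auto
  qed (use g a front in auto)
qed

text \<open>The circle acting on the target with weights d and e; \<open>powi\<close> admits
  negative weights.\<close>

definition circle_act :: "int \<Rightarrow> int \<Rightarrow> complex \<Rightarrow> complex \<times> complex \<Rightarrow> complex \<times> complex" where
  "circle_act d e c v = (c powi d * fst v, c powi e * snd v)"

definition circle_equivariant :: "int \<Rightarrow> int \<Rightarrow> (complex \<times> complex \<Rightarrow> complex \<times> complex) \<Rightarrow> bool" where
  "circle_equivariant d e s \<longleftrightarrow>
     (\<forall>c z. norm c = 1 \<longrightarrow> norm z = 1 \<longrightarrow> s (c * fst z, c * snd z) = circle_act d e c (s z))"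

lemma norm_circle_act: "norm c = 1 \<Longrightarrow> norm (circle_act d e c v) = norm v"
  by (cases v) (simp add: circle_act_def norm_Pair norm_mult norm_power_int)

lemma circle_act_mult: "circle_act d e (b * c) v = circle_act d e b (circle_act d e c v)"
  by (simp add: circle_act_def power_int_mult_distrib)

lemma continuous_on_circle_act [continuous_intros]:
  assumes "continuous_on S f" "continuous_on S g" "\<And>x. x \<in> S \<Longrightarrow> f x \<noteq> 0"
  shows "continuous_on S (\<lambda>x. circle_act d e (f x) (g x))"
  unfolding circle_act_def using assms by (intro continuous_intros) auto

lemma sgn_Pair: "sgn (a, b) = (a /\<^sub>R norm (a, b), b /\<^sub>R norm (a, b))"
  by (simp add: sgn_div_norm)

text \<open>For use with the chart vectors (1, w) and (w, 1), which are not of norm 1: radial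
  projection commutes with multiplication by a unit scalar.\<close>

lemma circle_equivariant_sgn:
  assumes "circle_equivariant d e s" "norm c = 1" "v \<noteq> 0"
  shows "circle_act d e c (s (sgn v)) = s (sgn (c * fst v, c * snd v))"
proof -
  obtain a b where v: "v = (a, b)" by fastforce
  have "norm (sgn v) = 1"
    using assms(3) by (simp add: norm_sgn)
  then have "circle_act d e c (s (sgn v)) = s (c * fst (sgn v), c * snd (sgn v))"
    using assms by (simp add: circle_equivariant_def)
  moreover have "norm (c * a, c * b) = norm (a, b)"
    using assms(2) by (simp add: norm_Pair norm_mult)
  ultimately show ?thesis
    by (simp add: v sgn_Pair)
qed

text \<open>An equivariant map is determined by one value on each circle orbit, so the homotopy is
  built over the projective line. It is extended first over one disc, then over the other with the
  boundary values forced by the first; each cylinder of time and disc has real dimension 3, so the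
  extension into the 3-sphere exists.\<close>

lemma sphere_degree_circle_equivariant_unit:
  assumes S: "continuous_on (sphere 0 1) S" "\<And>z. norm z = 1 \<Longrightarrow> norm (S z) = 1" "circle_equivariant d e S"
    and T: "continuous_on (sphere 0 1) T" "\<And>z. norm z = 1 \<Longrightarrow> norm (T z) = 1" "circle_equivariant d e T"
  shows "sphere_degree S = sphere_degree T"
proof -
  let ?I = "{0..1::real}" and ?D = "cball 0 1 :: complex set" and ?C = "sphere 0 1 :: complex set"
  have dim: "DIM(real \<times> complex) < DIM(complex \<times> complex)" by simp
  have sub: "{0, 1::real} \<times> ?D = {0} \<times> ?D \<union> {1} \<times> ?D" by auto
  \<comment> \<open>The values at times 0 and 1 are prescribed on two disjoint closed slices, so
    they are jointly continuous.\<close>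
  have ends: "continuous_on ({0,1} \<times> ?D) (\<lambda>(\<tau>, w). if \<tau> = (0::real) then S (j w) else T (j w))"
    if "continuous_on ?D j" "j \<in> ?D \<rightarrow> sphere 0 1" for j
  proof -
    have "continuous_on ({0} \<times> ?D \<union> {1} \<times> ?D) (\<lambda>x. if fst x = (0::real) then S (j (snd x)) else T (j (snd x)))"
      by (rule continuous_on_cases)
        (use that in \<open>auto intro!: closed_Times continuous_on_compose2 [OF S(1)] continuous_on_compose2 [OF T(1)]
           continuous_on_compose2 [OF that(1)] continuous_on_snd continuous_on_id\<close>)
    then show ?thesis
      by (simp add: sub case_prod_unfold)
  qed
  have sgn1: "norm (sgn (1::complex, w)) = 1" "norm (sgn (w, 1::complex)) = 1" for w :: complex
    by (auto simp: norm_sgn zero_prod_def)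
  have jcont: "continuous_on ?D (\<lambda>w. sgn (1::complex, w))" "continuous_on ?D (\<lambda>w. sgn (w, 1::complex))"
    unfolding sgn_div_norm by (auto intro!: continuous_intros simp: zero_prod_def)
  \<comment> \<open>\<open>\<alpha>\<close> and \<open>\<beta>\<close> are the homotopy on the discs \<open>[1 : w]\<close> and \<open>[w : 1]\<close> covering the projective line.\<close>
  define f1 where "f1 = (\<lambda>(\<tau>, w). if \<tau> = (0::real) then S (sgn (1, w)) else T (sgn (1, w)))"
  obtain \<alpha> where \<alpha>: "continuous_on (?I \<times> ?D) \<alpha>" "\<alpha> \<in> ?I \<times> ?D \<rightarrow> sphere 0 1"
      "\<And>x. x \<in> {0,1} \<times> ?D \<Longrightarrow> \<alpha> x = f1 x"
  proof (rule extend_map_to_sphere_lowdim [OF dim, of "{0,1} \<times> ?D" "?I \<times> ?D" f1])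
    show "continuous_on ({0, 1} \<times> ?D) f1"
      unfolding f1_def by (rule ends) (use jcont sgn1 in auto)
    show "f1 \<in> {0, 1} \<times> ?D \<rightarrow> sphere 0 1"
      by (auto simp: f1_def S(2) T(2) sgn1)
  qed (auto intro!: closed_Times bounded_Times)
  define f2 where "f2 = (\<lambda>x. if norm (snd x) = 1 then circle_act d e (snd x) (\<alpha> (fst x, 1 / snd x))
      else (\<lambda>(\<tau>, w). if \<tau> = (0::real) then S (sgn (w, 1)) else T (sgn (w, 1))) x)"
  \<comment> \<open>On the circle bounding both discs, equivariance forces \<open>\<beta> (\<tau>, v) = v \<cdot> \<alpha> (\<tau>, 1 / v)\<close>; on the
    boundary of the cylinder \<open>[0, 1] \<times> D\<close> this agrees with the values at \<open>\<tau> = 0, 1\<close>.\<close>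
  have glue: "circle_act d e v (\<alpha> (\<tau>, 1 / v)) = (\<lambda>(\<tau>, w). if \<tau> = (0::real) then S (sgn (w, 1)) else T (sgn (w, 1))) (\<tau>, v)"
    if "norm v = 1" "\<tau> \<in> {0,1}" for v \<tau>
  proof -
    have v: "v \<noteq> 0" using that by auto
    have "\<alpha> (\<tau>, 1 / v) = f1 (\<tau>, 1 / v)"
      using that by (intro \<alpha>) (auto simp: norm_divide)
    moreover have "circle_act d e v (S (sgn (1, 1 / v))) = S (sgn (v, 1))"
      using circle_equivariant_sgn [OF S(3) that(1), of "(1, 1/v)"] v by (simp add: zero_prod_def)
    moreover have "circle_act d e v (T (sgn (1, 1 / v))) = T (sgn (v, 1))"
      using circle_equivariant_sgn [OF T(3) that(1), of "(1, 1/v)"] v by (simp add: zero_prod_def)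
    ultimately show ?thesis by (simp add: f1_def)
  qed
  obtain \<beta> where \<beta>: "continuous_on (?I \<times> ?D) \<beta>" "\<beta> \<in> ?I \<times> ?D \<rightarrow> sphere 0 1"
      "\<And>x. x \<in> ?I \<times> ?C \<union> {0,1} \<times> ?D \<Longrightarrow> \<beta> x = f2 x"
  proof (rule extend_map_to_sphere_lowdim [OF dim, of "?I \<times> ?C \<union> {0,1} \<times> ?D" "?I \<times> ?D" f2])
    show "continuous_on (?I \<times> ?C \<union> {0,1} \<times> ?D) f2"
      unfolding f2_def
    proof (rule continuous_on_cases)
      show "continuous_on (?I \<times> ?C) (\<lambda>x. circle_act d e (snd x) (\<alpha> (fst x, 1 / snd x)))"
        by (intro continuous_intros continuous_on_compose2 [OF \<alpha>(1)]) (auto simp: norm_divide)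
      show "continuous_on ({0, 1} \<times> ?D) (\<lambda>(\<tau>, w). if \<tau> = (0::real) then S (sgn (w, 1)) else T (sgn (w, 1)))"
        by (rule ends) (use jcont sgn1 in auto)
    next
      show "\<forall>x. x \<in> ?I \<times> ?C \<and> norm (snd x) \<noteq> 1 \<or> x \<in> {0,1} \<times> ?D \<and> norm (snd x) = 1 \<longrightarrow>
         circle_act d e (snd x) (\<alpha> (fst x, 1 / snd x))
         = (\<lambda>(\<tau>, w). if \<tau> = (0::real) then S (sgn (w, 1)) else T (sgn (w, 1))) x"
        using glue by fastforce
    qed (auto intro!: closed_Times)
    show "f2 \<in> ?I \<times> ?C \<union> {0,1} \<times> ?D \<rightarrow> sphere 0 1"
    proof (rule Pi_I)
      fix x assume x: "x \<in> ?I \<times> ?C \<union> {0,1} \<times> ?D"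
      show "f2 x \<in> sphere 0 1"
      proof (cases "norm (snd x) = 1")
        case True
        then have "(fst x, 1 / snd x) \<in> ?I \<times> ?D"
          using x by (auto simp: norm_divide)
        with \<alpha>(2) True show ?thesis
          by (auto simp: f2_def norm_circle_act)
      next
        case False
        with x show ?thesis
          by (auto simp: f2_def S(2) T(2) sgn1)
      qed
    qed
  qed (auto intro!: closed_Times closed_Un bounded_Times)
  \<comment> \<open>Spreads \<alpha> and \<beta> over the orbits: (a, b) with |b| \<le> |a| is the
    phase \<open>sgn a\<close> acting on the normalised vector (1, b / a); otherwise the phase of b
    acts on (a / b, 1).\<close>
  define h where "h = (\<lambda>x::real \<times> complex \<times> complex.
     if norm (snd (snd x)) - norm (fst (snd x)) \<le> 0
     then circle_act d e (sgn (fst (snd x))) (\<alpha> (fst x, snd (snd x) / fst (snd x)))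
     else circle_act d e (sgn (snd (snd x))) (\<beta> (fst x, fst (snd x) / snd (snd x))))"
  have nz1: "fst z \<noteq> 0" if "norm z = 1" "norm (snd z) \<le> norm (fst z)" for z :: "complex \<times> complex"
    using that by (cases z) (auto simp: zero_prod_def)
  have nz2: "snd z \<noteq> 0" if "norm z = 1" "norm (fst z) \<le> norm (snd z)" for z :: "complex \<times> complex"
    using that by (cases z) (auto simp: zero_prod_def)
  have act1: "circle_act d e (sgn (fst z)) (s (sgn (1, snd z / fst z))) = s z"
    if "circle_equivariant d e s" "norm z = 1" "fst z \<noteq> 0" for s z
  proof -
    have "(sgn (fst z) * 1, sgn (fst z) * (snd z / fst z)) = z /\<^sub>R norm (fst z)"
      using that by (cases z) (simp add: sgn_div_norm scaleR_conv_of_real)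
    moreover have "sgn (z /\<^sub>R norm (fst z)) = z"
      using that by (simp add: sgn_scaleR) (simp add: sgn_div_norm)
    ultimately show ?thesis
      using circle_equivariant_sgn [OF that(1), of "sgn (fst z)" "(1, snd z / fst z)"] that
      by (simp add: norm_sgn zero_prod_def)
  qed
  have act2: "circle_act d e (sgn (snd z)) (s (sgn (fst z / snd z, 1))) = s z"
    if "circle_equivariant d e s" "norm z = 1" "snd z \<noteq> 0" for s z
  proof -
    have "(sgn (snd z) * (fst z / snd z), sgn (snd z) * 1) = z /\<^sub>R norm (snd z)"
      using that by (cases z) (simp add: sgn_div_norm scaleR_conv_of_real)
    moreover have "sgn (z /\<^sub>R norm (snd z)) = z"
      using that by (simp add: sgn_scaleR) (simp add: sgn_div_norm)
    ultimately show ?thesis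
      using circle_equivariant_sgn [OF that(1), of "sgn (snd z)" "(fst z / snd z, 1)"] that
      by (simp add: norm_sgn zero_prod_def)
  qed
  have quot1: "snd z / fst z \<in> ?D" if "norm z = 1" "norm (snd z) \<le> norm (fst z)" for z :: "complex \<times> complex"
    using that nz1 [OF that] by (simp add: norm_divide)
  have quot2: "fst z / snd z \<in> ?D" if "norm z = 1" "norm (fst z) \<le> norm (snd z)" for z :: "complex \<times> complex"
    using that nz2 [OF that] by (simp add: norm_divide)
  have h01: "h (\<tau>, z) = (if \<tau> = 0 then S z else T z)" if "\<tau> \<in> {0,1}" "norm z = 1" for \<tau> z
  proof (cases "norm (snd z) \<le> norm (fst z)")
    case True
    then show ?thesis
      using that quot1 [OF that(2) True] nz1 [OF that(2) True] act1 [OF S(3)] act1 [OF T(3)]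
      by (auto simp: h_def \<alpha>(3) f1_def)
  next
    case False
    then have "norm (fst z) \<le> norm (snd z)" by simp
    moreover have "\<beta> (\<tau>, fst z / snd z) = (if \<tau> = 0 then S (sgn (fst z / snd z, 1)) else T (sgn (fst z / snd z, 1)))"
    proof -
      \<comment> \<open>In this case |a| < |b| strictly, so the quotient is interior to the disc and
        \<open>f2\<close> takes its second branch.\<close>
      have "norm (fst z / snd z) \<noteq> 1"
        using False by (auto simp: norm_divide divide_simps)
      then show ?thesis
        using that quot2 [OF that(2) \<open>norm (fst z) \<le> norm (snd z)\<close>] by (auto simp: \<beta>(3) f2_def)
    qed
    ultimately show ?thesis
      using that False nz2 [OF that(2)] act2 [OF S(3)] act2 [OF T(3)]
      by (auto simp: h_def)
  qed
  have sgn_cont: "continuous_on X (\<lambda>x. sgn (f x))" if "continuous_on X f" "\<And>x. x \<in> X \<Longrightarrow> f x \<noteq> 0"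
    for X and f :: "real \<times> complex \<times> complex \<Rightarrow> complex"
    unfolding sgn_div_norm using that by (auto intro!: continuous_intros)
  show ?thesis
  proof (rule sphere_degree_homotopic [of h])
    show "continuous_on (?I \<times> sphere 0 1) h"
      unfolding h_def
    proof (rule continuous_on_cases_le)
      show "continuous_on {x \<in> ?I \<times> sphere 0 1. norm (snd (snd x)) - norm (fst (snd x)) \<le> 0}
         (\<lambda>x. circle_act d e (sgn (fst (snd x))) (\<alpha> (fst x, snd (snd x) / fst (snd x))))"
        using quot1 nz1
        by (intro continuous_intros continuous_on_compose2 [OF \<alpha>(1)] sgn_cont) (auto simp: sgn_zero_iff)
      show "continuous_on {x \<in> ?I \<times> sphere 0 1. 0 \<le> norm (snd (snd x)) - norm (fst (snd x))}
         (\<lambda>x. circle_act d e (sgn (snd (snd x))) (\<beta> (fst x, fst (snd x) / snd (snd x))))"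
        using quot2 nz2
        by (intro continuous_intros continuous_on_compose2 [OF \<beta>(1)] sgn_cont) (auto simp: sgn_zero_iff)
      show "continuous_on (?I \<times> sphere 0 1) (\<lambda>x. norm (snd (snd x)) - norm (fst (snd x)))"
        by (intro continuous_intros)
      fix x :: "real \<times> complex \<times> complex"
      assume x: "x \<in> ?I \<times> sphere 0 1" and eq: "norm (snd (snd x)) - norm (fst (snd x)) = 0"
      obtain \<tau> a b where xe: "x = (\<tau>, a, b)" by (metis prod.exhaust)
      have ab: "norm a = norm b" "a \<noteq> 0" "b \<noteq> 0"
        using x eq nz1 [of "(a,b)"] nz2 [of "(a,b)"] by (auto simp: xe)
      \<comment> \<open>On the torus |a| = |b| the forced boundary value of \<beta> supplies the
        phase a / b, and \<open>sgn b * (a / b) = sgn a\<close> makes the two branches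
        agree.\<close>
      have "\<beta> (\<tau>, a / b) = circle_act d e (a / b) (\<alpha> (\<tau>, b / a))"
        using x ab by (subst \<beta>(3)) (auto simp: xe f2_def norm_divide)
      moreover have "sgn b * (a / b) = sgn a"
        using ab by (simp add: sgn_div_norm scaleR_conv_of_real)
      ultimately show "circle_act d e (sgn (fst (snd x))) (\<alpha> (fst x, snd (snd x) / fst (snd x)))
         = circle_act d e (sgn (snd (snd x))) (\<beta> (fst x, fst (snd x) / snd (snd x)))"
        by (simp add: xe flip: circle_act_mult)
    qed
    fix \<tau> :: real and z :: "complex \<times> complex"
    assume \<tau>: "0 \<le> \<tau>" "\<tau> \<le> 1" and z: "norm z = 1"
    have "norm (h (\<tau>, z)) = 1"
    proof (cases "norm (snd z) \<le> norm (fst z)")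
      case True
      have "\<alpha> (\<tau>, snd z / fst z) \<in> sphere 0 1"
        using \<alpha>(2) quot1 [OF z True] \<tau> by (auto simp: Pi_iff)
      then show ?thesis
        using True nz1 [OF z True] by (simp add: h_def norm_circle_act norm_sgn)
    next
      case False
      then have le: "norm (fst z) \<le> norm (snd z)" by simp
      have "\<beta> (\<tau>, fst z / snd z) \<in> sphere 0 1"
        using \<beta>(2) quot2 [OF z le] \<tau> by (auto simp: Pi_iff)
      then show ?thesis
        using False nz2 [OF z le] by (simp add: h_def norm_circle_act norm_sgn)
    qed
    then show "h (\<tau>, z) \<noteq> 0" by auto
  qed (auto simp: h01)
qed

text \<open>Reduces to unit-valued maps: normalising leaves the degree alone and respects
  equivariance, since the action preserves norms.\<close>

theorem sphere_degree_circle_equivariant: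
  assumes s: "continuous_on (sphere 0 1) s" "\<And>z. norm z = 1 \<Longrightarrow> s z \<noteq> 0" "circle_equivariant d e s"
    and t: "continuous_on (sphere 0 1) t" "\<And>z. norm z = 1 \<Longrightarrow> t z \<noteq> 0" "circle_equivariant d e t"
  shows "sphere_degree s = sphere_degree t"
proof -
  have deg: "sphere_degree (\<lambda>z. sgn (f z)) = sphere_degree f" for f
  proof -
    have "sgn (sgn x) = sgn x" for x :: "complex \<times> complex"
      by (cases "x = 0") (simp_all add: sgn_div_norm)
    then show ?thesis
      unfolding sphere_degree_def by simp
  qed
  have cont: "continuous_on (sphere 0 1) (\<lambda>z. sgn (f z))"
    if "continuous_on (sphere 0 1) f" "\<And>z. norm z = 1 \<Longrightarrow> f z \<noteq> 0" for f :: "complex \<times> complex \<Rightarrow> complex \<times> complex"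
    unfolding sgn_div_norm using that by (auto intro!: continuous_intros)
  have equi: "circle_equivariant d e (\<lambda>z. sgn (f z))" if "circle_equivariant d e f" for f
  proof -
    have "sgn (circle_act d e c v) = circle_act d e c (sgn v)" if "norm c = 1" for c v
      unfolding sgn_div_norm norm_circle_act [OF that]
      by (simp add: circle_act_def)
    then show ?thesis
      using that by (simp add: circle_equivariant_def)
  qed
  have "sphere_degree (\<lambda>z. sgn (s z)) = sphere_degree (\<lambda>z. sgn (t z))"
    by (rule sphere_degree_circle_equivariant_unit [of _ d e])
      (use cont equi s t in \<open>auto simp: norm_sgn\<close>)
  then show ?thesis
    by (simp add: deg)
qed

section \<open>Degrees of power maps\<close>

lemma sphere_degree_id: "sphere_degree (\<lambda>z. z) = 1"
proof -
  have "sphere_degree (\<lambda>z. z) = Brouwer_degree2 3 id"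
    unfolding sphere_degree_def
    by (rule Brouwer_degree2_eq) (simp add: sgn_div_norm norm_to_C2_nsphere of_C2_to_C2)
  then show ?thesis
    by simp
qed

lemma sphere_degree_const: "sphere_degree (\<lambda>z. v) = 0"
  unfolding sphere_degree_def by (rule Brouwer_degree2_const)

text \<open>By \<open>hom\<close> the direction of \<xi> depends only on the direction of its
  argument, so normalising \<psi> before applying \<xi> does not change the composite.\<close>

lemma sphere_degree_compose:
  assumes \<psi>: "continuous_on (sphere 0 1) \<psi>" "\<And>z. norm z = 1 \<Longrightarrow> \<psi> z \<noteq> 0"
    and \<xi>: "continuous_on (sphere 0 1) \<xi>" "\<And>z. norm z = 1 \<Longrightarrow> \<xi> z \<noteq> 0"
    and hom: "\<And>z. z \<noteq> 0 \<Longrightarrow> sgn (\<xi> (sgn z)) = sgn (\<xi> z)"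
  shows "sphere_degree (\<lambda>z. \<xi> (\<psi> z)) = sphere_degree \<xi> * sphere_degree \<psi>"
proof -
  let ?f = "\<lambda>u. of_C2 (sgn (\<psi> (to_C2 u)))" and ?g = "\<lambda>u. of_C2 (sgn (\<xi> (to_C2 u)))"
  have "sphere_degree (\<lambda>z. \<xi> (\<psi> z)) = Brouwer_degree2 3 (?g \<circ> ?f)"
    unfolding sphere_degree_def
    by (rule Brouwer_degree2_eq) (simp add: hom \<psi>(2) norm_to_C2_nsphere)
  also have "\<dots> = Brouwer_degree2 3 ?g * Brouwer_degree2 3 ?f"
    by (intro Brouwer_degree2_compose continuous_map_sphere_degree_to_C2 \<psi> \<xi>)
  finally show ?thesis
    by (simp add: sphere_degree_def)
qed

lemma sphere_degree_compose_isometry: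
  assumes \<psi>: "continuous_on (sphere 0 1) \<psi>" "\<And>z. norm z = 1 \<Longrightarrow> \<psi> z \<noteq> 0"
    and \<xi>: "linear \<xi>" "\<And>z. norm (\<xi> z) = norm z"
  shows "sphere_degree (\<lambda>z. \<xi> (\<psi> z)) = sphere_degree \<xi> * sphere_degree \<psi>"
proof (rule sphere_degree_compose [OF \<psi>])
  show "continuous_on (sphere 0 1) \<xi>"
    using \<xi>(1) by (simp add: linear_continuous_on linear_linear)
  show "\<xi> z \<noteq> 0" if "norm z = 1" for z
    using \<xi>(2) [of z] that by auto
  show "sgn (\<xi> (sgn z)) = sgn (\<xi> z)" if "z \<noteq> 0" for z
    unfolding sgn_div_norm linear_scale [OF \<xi>(1)] using that by (simp add: \<xi>(2))
qed

text \<open>The paths \<open>exp (t * Ln p)\<close> and \<open>exp (t * Ln q)\<close> run from 1 to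
  p and q without vanishing and scale the components along the way.\<close>

lemma sphere_degree_scale_components:
  assumes a: "continuous_on (sphere 0 1) a" and b: "continuous_on (sphere 0 1) b"
    and nz: "\<And>z. norm z = 1 \<Longrightarrow> a z \<noteq> 0 \<or> b z \<noteq> 0" and "p \<noteq> 0" "q \<noteq> 0"
  shows "sphere_degree (\<lambda>z. (p * a z, q * b z)) = sphere_degree (\<lambda>z. (a z, b z))"
proof (rule sym, rule sphere_degree_homotopic)
  let ?h = "\<lambda>x. (exp (of_real (fst x) * Ln p) * a (snd x), exp (of_real (fst x) * Ln q) * b (snd x))"
  show "continuous_on ({0..1} \<times> sphere 0 1) ?h"
    by (intro continuous_intros continuous_on_compose2 [OF a] continuous_on_compose2 [OF b]) auto
  show "?h (t, z) \<noteq> 0" if "norm z = 1" for t z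
    using nz [OF that] by (auto simp: zero_prod_def)
qed (use assms in auto)

text \<open>Passing to \<open>- cnj\<close> changes the sign of the real part only, which is the
  reflection in coordinate 0.\<close>

lemma sphere_degree_reflection: "sphere_degree (\<lambda>z. (- cnj (fst z), snd z)) = -1"
proof -
  have "sphere_degree (\<lambda>z. (- cnj (fst z), snd z)) = Brouwer_degree2 3 (\<lambda>x i. if i = 0 then - x i else x i)"
    unfolding sphere_degree_def
  proof (rule Brouwer_degree2_eq)
    fix u assume u: "u \<in> topspace (nsphere 3)"
    let ?w = "(- cnj (fst (to_C2 u)), snd (to_C2 u))"
    have "norm ?w = 1"
      using norm_to_C2_nsphere [OF u] by (cases "to_C2 u") (simp add: norm_Pair)
    then have "of_C2 (sgn ?w) = of_C2 ?w"
      by (simp add: sgn_div_norm)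
    also have "\<dots> = (\<lambda>i. if i = 0 then - (of_C2 (to_C2 u)) i else (of_C2 (to_C2 u)) i)"
      by (auto simp: of_C2_def phi4_def fun_eq_iff)
    finally show "of_C2 (sgn ?w) = (\<lambda>i. if i = 0 then - u i else u i)"
      by (simp only: of_C2_to_C2 [OF u])
  qed
  then show ?thesis
    by (simp add: Brouwer_degree2_reflection)
qed

lemma norm_one_cases: "norm (z :: complex \<times> complex) = 1 \<Longrightarrow> fst z \<noteq> 0 \<or> snd z \<noteq> 0"
  by (cases z) (auto simp: zero_prod_def)

lemma linear_Pair_cnj:
  "linear (\<lambda>z. (cnj (fst z), snd z))" "linear (\<lambda>z. (fst z, cnj (snd z)))"
  by (auto intro!: linearI simp: scaleR_conv_of_real)

lemma sphere_degree_cnj_fst: "sphere_degree (\<lambda>z. (cnj (fst z), snd z)) = -1"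
proof -
  have "sphere_degree (\<lambda>z. ((-1) * cnj (fst z), 1 * snd z)) = sphere_degree (\<lambda>z. (cnj (fst z), snd z))"
    using norm_one_cases by (intro sphere_degree_scale_components continuous_intros) auto
  then show ?thesis
    by (simp add: sphere_degree_reflection)
qed

text \<open>Conjugating the second coordinate is conjugating the first between two swaps. The degree
  of the swap enters squared, and its square is 1 because the swap is an involution.\<close>

lemma sphere_degree_cnj_snd: "sphere_degree (\<lambda>z. (fst z, cnj (snd z))) = -1"
proof -
  define sw where "sw z = (snd z, fst z)" for z :: "complex \<times> complex"
  have sw: "linear sw" "\<And>z. norm (sw z) = norm z" "continuous_on (sphere 0 1) sw"
    by (auto intro!: linearI continuous_intros simp: sw_def norm_prod_def add.commute)
  have swnz: "sw z \<noteq> 0" if "norm z = 1" for z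
    using sw(2) [of z] that by auto
  have "sphere_degree sw * sphere_degree sw = sphere_degree (\<lambda>z. sw (sw z))"
    by (rule sphere_degree_compose_isometry [symmetric]) (use sw swnz in auto)
  then have 1: "sphere_degree sw * sphere_degree sw = 1"
    by (simp add: sw_def sphere_degree_id)
  have "sphere_degree (\<lambda>z. (\<lambda>z. (cnj (fst z), snd z)) (sw z)) = sphere_degree (\<lambda>z. (cnj (fst z), snd z)) * sphere_degree sw"
    by (rule sphere_degree_compose_isometry) (use sw swnz in \<open>auto simp: linear_Pair_cnj norm_prod_def\<close>)
  then have 2: "sphere_degree (\<lambda>z. (cnj (snd z), fst z)) = - sphere_degree sw"
    by (simp add: sw_def sphere_degree_cnj_fst)
  have "sphere_degree (\<lambda>z. sw ((\<lambda>z. (cnj (snd z), fst z)) z)) = sphere_degree sw * sphere_degree (\<lambda>z. (cnj (snd z), fst z))"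
    by (rule sphere_degree_compose_isometry)
      (use sw norm_one_cases in \<open>auto simp: zero_prod_def intro!: continuous_intros\<close>)
  then show ?thesis
    using 1 2 by (simp add: sw_def)
qed

section \<open>The degree of the power map, by counting roots of unity\<close>

lemma finite_isolated_radius:
  fixes P :: "'a::metric_space"
  assumes "finite Z"
  shows "\<exists>r>0. \<forall>Q\<in>Z. dist P Q \<le> r \<longrightarrow> Q = P"
proof -
  obtain \<delta> where "\<delta> > 0" and \<delta>: "\<forall>Q\<in>Z. Q \<noteq> P \<longrightarrow> \<delta> \<le> dist P Q"
    using finite_set_avoid [OF assms] by blast
  then have "\<forall>Q\<in>Z. dist P Q \<le> \<delta> / 2 \<longrightarrow> Q = P"
    by force
  with \<open>\<delta> > 0\<close> show ?thesis
    by (intro exI [of _ "\<delta> / 2"]) auto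
qed

lemma sphere_degree_power_local:
  fixes \<zeta> \<omega> :: complex
  assumes mn: "m > 0" "n > 0" and z: "\<zeta> ^ m = 1" "\<omega> ^ n = 1" and "r > 0"
    and iso: "\<And>a b. a ^ m = 1 \<Longrightarrow> b ^ n = 1 \<Longrightarrow> dist (\<zeta>, \<omega>) (a, b) \<le> r \<Longrightarrow> (a, b) = (\<zeta>, \<omega>)"
  shows "sphere_degree (\<lambda>z. ((\<zeta> + r *\<^sub>R fst z) ^ m - 1, (\<omega> + r *\<^sub>R snd z) ^ n - 1)) = 1"
proof -
  \<comment> \<open>\<open>Q\<close> is the cofactor of \<open>x - c\<close> in \<open>x\<^sup>k - 1\<close>; since it has no zero near \<open>c\<close>, shrinking its
    argument to \<open>c\<close> deforms the map to a diagonal linear one.\<close>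
  define Q where "Q k c x = (\<Sum>i<k. c ^ (k - Suc i) * x ^ i)" for k and c x :: complex
  have Q: "x ^ k - 1 = (x - c) * Q k c x" if "c ^ k = 1" for x c k
    using power_diff_sumr2 [of x k c] that by (simp add: Q_def)
  have Q0: "Q k c c \<noteq> 0" if "k > 0" "c ^ k = 1" for c k
  proof -
    have "Q k c c = (\<Sum>i<k. c ^ (k - 1))"
      unfolding Q_def by (rule sum.cong) (auto simp flip: power_add)
    moreover have "c \<noteq> 0"
      using that by (auto simp: zero_power)
    ultimately show ?thesis
      using that by simp
  qed
  \<comment> \<open>A zero of the cofactor would be an m-th root of unity inside the isolating ball,
    hence \<zeta> itself, where the cofactor is m * \<zeta>^(m - 1) and does not vanish.\<close>
  have Q1: "Q m \<zeta> (\<zeta> + r *\<^sub>R w) \<noteq> 0" if "norm w \<le> 1" for w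
  proof
    assume 0: "Q m \<zeta> (\<zeta> + r *\<^sub>R w) = 0"
    then have "(\<zeta> + r *\<^sub>R w) ^ m = 1"
      using Q [OF z(1), of "\<zeta> + r *\<^sub>R w"] by simp
    moreover have "dist (\<zeta>, \<omega>) (\<zeta> + r *\<^sub>R w, \<omega>) \<le> r"
      using that \<open>r > 0\<close> by (simp add: dist_Pair_Pair dist_norm)
    ultimately have "\<zeta> + r *\<^sub>R w = \<zeta>"
      using iso z(2) by blast
    with 0 Q0 [OF mn(1) z(1)] show False by simp
  qed
  have Q2: "Q n \<omega> (\<omega> + r *\<^sub>R w) \<noteq> 0" if "norm w \<le> 1" for w
  proof
    assume 0: "Q n \<omega> (\<omega> + r *\<^sub>R w) = 0"
    then have "(\<omega> + r *\<^sub>R w) ^ n = 1"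
      using Q [OF z(2), of "\<omega> + r *\<^sub>R w"] by simp
    moreover have "dist (\<zeta>, \<omega>) (\<zeta>, \<omega> + r *\<^sub>R w) \<le> r"
      using that \<open>r > 0\<close> by (simp add: dist_Pair_Pair dist_norm)
    ultimately have "\<omega> + r *\<^sub>R w = \<omega>"
      using iso z(1) by blast
    with 0 Q0 [OF mn(2) z(2)] show False by simp
  qed
  have contQ: "continuous_on S (\<lambda>x. Q k c (f x))" if "continuous_on S f"
    for S and f :: "real \<times> complex \<times> complex \<Rightarrow> complex" and k c
    unfolding Q_def using that by (intro continuous_intros)
  let ?p = "of_real r * Q m \<zeta> \<zeta>" and ?q = "of_real r * Q n \<omega> \<omega>"
  let ?h = "\<lambda>x. ((r *\<^sub>R fst (snd x)) * Q m \<zeta> (\<zeta> + r *\<^sub>R (fst x *\<^sub>R fst (snd x))),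
                 (r *\<^sub>R snd (snd x)) * Q n \<omega> (\<omega> + r *\<^sub>R (fst x *\<^sub>R snd (snd x))))"
  have "sphere_degree (\<lambda>z. (?p * fst z, ?q * snd z))
      = sphere_degree (\<lambda>z. ((\<zeta> + r *\<^sub>R fst z) ^ m - 1, (\<omega> + r *\<^sub>R snd z) ^ n - 1))"
  proof (rule sphere_degree_homotopic [of ?h])
    show "continuous_on ({0..1} \<times> sphere 0 1) ?h"
      by (intro continuous_intros contQ)
    fix t :: real and z :: "complex \<times> complex"
    assume t: "0 \<le> t" "t \<le> 1" and z: "norm z = 1"
    have "norm (fst z) \<le> 1" "norm (snd z) \<le> 1"
      using norm_fst_le [of "fst z" "snd z"] norm_snd_le [of "snd z" "fst z"] z by auto
    then have "norm (t *\<^sub>R fst z) \<le> 1" "norm (t *\<^sub>R snd z) \<le> 1"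
      using t by (simp_all add: mult_le_one)
    note Q12 = Q1 [OF this(1)] Q2 [OF this(2)]
    show "?h (t, z) \<noteq> 0"
      using norm_one_cases [OF z] Q12 \<open>r > 0\<close> by (auto simp: zero_prod_def)
  next
    fix z :: "complex \<times> complex"
    show "?h (1, z) = ((\<zeta> + r *\<^sub>R fst z) ^ m - 1, (\<omega> + r *\<^sub>R snd z) ^ n - 1)"
      by (simp add: Q [OF z(1)] Q [OF z(2)])
  qed (simp add: scaleR_conv_of_real)
  moreover have "sphere_degree (\<lambda>z. (?p * fst z, ?q * snd z)) = sphere_degree (\<lambda>z. (fst z, snd z))"
    using norm_one_cases Q0 mn z \<open>r > 0\<close>
    by (intro sphere_degree_scale_components continuous_intros) auto
  ultimately show ?thesis
    by (simp add: sphere_degree_id)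
qed

text \<open>Subtracting 1 from both components does not change the degree on a large sphere and
  splits the zero at the origin into m * n zeros, each of local degree 1.\<close>

lemma sphere_degree_power:
  assumes mn: "m > 0" "n > 0"
  shows "sphere_degree (\<lambda>z. (fst z ^ m, snd z ^ n)) = int m * int n"
proof -
  define \<psi> where "\<psi> z = (fst z ^ m - 1, snd z ^ n - 1)" for z :: "complex \<times> complex"
  have zeros: "{z. \<psi> z = 0} = {z. z ^ m = 1} \<times> {z. z ^ n = 1}"
    by (auto simp: \<psi>_def zero_prod_def)
  have fin: "finite {z. \<psi> z = 0}"
    unfolding zeros using mn by (intro finite_cartesian_product finite_roots_unity) auto
  have "\<forall>P. \<exists>r>0. \<forall>Q\<in>{z. \<psi> z = 0}. dist P Q \<le> r \<longrightarrow> Q = P"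
    using finite_isolated_radius [OF fin] by (intro allI)
  from choice [OF this] obtain r where r: "\<And>P. r P > 0" "\<And>P Q. \<psi> Q = 0 \<Longrightarrow> dist P Q \<le> r P \<Longrightarrow> Q = P"
    by blast
  \<comment> \<open>Radius 3 suffices: both coordinates of a zero have modulus 1, so its norm is at
    most 2.\<close>
  have "sphere_degree (\<lambda>z. \<psi> (3 *\<^sub>R z)) = (\<Sum>P | \<psi> P = 0. sphere_degree (\<lambda>z. \<psi> (P + r P *\<^sub>R z)))"
  proof (rule sphere_degree_eq_sum [OF _ fin _ r(1) r(2)])
    show "continuous_on UNIV \<psi>"
      unfolding \<psi>_def by (intro continuous_intros)
    fix z assume "\<psi> z = 0"
    then have "norm (fst z) = 1" "norm (snd z) = 1"
      using mn power_eq_1_iff [of "fst z" m] power_eq_1_iff [of "snd z" n]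
      by (auto simp: \<psi>_def zero_prod_def)
    then show "norm z < 3"
      using norm_Pair_le [of "fst z" "snd z"] by simp
  qed auto
  also have "\<dots> = (\<Sum>P | \<psi> P = 0. 1)"
  proof (rule sum.cong [OF refl])
    fix P assume P: "P \<in> {P. \<psi> P = 0}"
    have "sphere_degree (\<lambda>z. ((fst P + r P *\<^sub>R fst z) ^ m - 1, (snd P + r P *\<^sub>R snd z) ^ n - 1)) = 1"
    proof (rule sphere_degree_power_local [OF mn])
      fix a b assume "a ^ m = 1" "b ^ n = 1" "dist (fst P, snd P) (a, b) \<le> r P"
      then show "(a, b) = (fst P, snd P)"
        using r(2) [of "(a, b)" P] by (simp add: \<psi>_def zero_prod_def)
    qed (use P r(1) in \<open>auto simp: \<psi>_def zero_prod_def\<close>)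
    then show "sphere_degree (\<lambda>z. \<psi> (P + r P *\<^sub>R z)) = 1"
      by (simp add: \<psi>_def)
  qed
  also have "\<dots> = int m * int n"
    by (simp add: zeros card_cartesian_product card_roots_unity_eq mn)
  also have "sphere_degree (\<lambda>z. \<psi> (3 *\<^sub>R z)) = sphere_degree (\<lambda>z. (3 ^ m * fst z ^ m, 3 ^ n * snd z ^ n))"
  proof (rule sphere_degree_homotopic)
    \<comment> \<open>The constant 1 is moved to 0. At a zero both coordinates would have modulus at
      most 1/3, since |w| > 1/3 gives |3w|^k > 1; this contradicts norm 1.\<close>
    let ?h = "\<lambda>x. (3 ^ m * fst (snd x) ^ m - of_real (1 - fst x), 3 ^ n * snd (snd x) ^ n - of_real (1 - fst x)) :: complex \<times> complex"
    show "continuous_on ({0..1} \<times> sphere 0 1) ?h"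
      by (intro continuous_intros)
    fix t :: real and z :: "complex \<times> complex"
    assume t: "0 \<le> t" "t \<le> 1" and z: "norm z = 1"
    have small: "norm w \<le> 1/3" if "3 ^ k * w ^ k - of_real (1 - t) = 0" "k > 0" for w :: complex and k
    proof (rule ccontr)
      assume "\<not> norm w \<le> 1/3"
      then have "norm (3 * w) ^ k > 1"
        using that(2) by (intro one_less_power) (auto simp: norm_mult)
      moreover have "(3 * w) ^ k = of_real (1 - t)"
        using that(1) by (simp add: power_mult_distrib)
      then have "norm (3 * w) ^ k = \<bar>1 - t\<bar>"
        by (metis norm_of_real norm_power)
      ultimately show False
        using t by simp
    qed
    show "?h (t, z) \<noteq> 0"
    proof
      assume "?h (t, z) = 0"
      then have "norm (fst z) \<le> 1/3" "norm (snd z) \<le> 1/3"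
        using small mn by (auto simp: zero_prod_def)
      then show False
        using norm_Pair_le [of "fst z" "snd z"] z by simp
    qed
  qed (auto simp: \<psi>_def power_mult_distrib scaleR_conv_of_real)
  also have "\<dots> = sphere_degree (\<lambda>z. (fst z ^ m, snd z ^ n))"
    using norm_one_cases mn by (intro sphere_degree_scale_components continuous_intros) auto
  finally show ?thesis .
qed

text \<open>Makes \<open>cnj_if_neg d z ^ nat \<bar>d\<bar>\<close> a model of weight d for either
  sign of d.\<close>

definition cnj_if_neg :: "int \<Rightarrow> complex \<Rightarrow> complex" where
  "cnj_if_neg d z = (if d < 0 then cnj z else z)"

text \<open>The map factors into positive powers followed by a possible conjugation of each
  coordinate; each conjugation contributes the sign of its exponent.\<close>

lemma sphere_degree_signed_power:
  assumes "d \<noteq> 0" "e \<noteq> 0"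
  shows "sphere_degree (\<lambda>z. (cnj_if_neg d (fst z) ^ nat \<bar>d\<bar>, cnj_if_neg e (snd z) ^ nat \<bar>e\<bar>)) = d * e"
proof -
  define P where "P z = (fst z ^ nat \<bar>d\<bar>, snd z ^ nat \<bar>e\<bar>)" for z :: "complex \<times> complex"
  define A where "A z = (cnj_if_neg d (fst z), snd z)" for z :: "complex \<times> complex"
  define B where "B z = (fst z, cnj_if_neg e (snd z))" for z :: "complex \<times> complex"
  have P: "continuous_on (sphere 0 1) P" "\<And>z. norm z = 1 \<Longrightarrow> P z \<noteq> 0"
    unfolding P_def using norm_one_cases assms by (auto intro!: continuous_intros simp: zero_prod_def)
  have A: "linear A"
    unfolding A_def using linear_Pair_cnj(1) by (cases "d < 0") (simp_all add: cnj_if_neg_def linear_ident)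
  have A': "norm (A z) = norm z" for z
    by (simp add: A_def cnj_if_neg_def norm_prod_def)
  have B: "linear B"
    unfolding B_def using linear_Pair_cnj(2) by (cases "e < 0") (simp_all add: cnj_if_neg_def linear_ident)
  have B': "norm (B z) = norm z" for z
    by (simp add: B_def cnj_if_neg_def norm_prod_def)
  have BP: "continuous_on (sphere 0 1) (\<lambda>z. B (P z))" "\<And>z. norm z = 1 \<Longrightarrow> B (P z) \<noteq> 0"
    using linear_continuous_on_compose [OF P(1) B] P(2) B' norm_eq_zero by metis+
  have "sphere_degree (\<lambda>z. A (B (P z))) = sphere_degree A * (sphere_degree B * sphere_degree P)"
    using sphere_degree_compose_isometry [OF BP A A'] sphere_degree_compose_isometry [OF P B B'] by simp
  moreover have "sphere_degree A = sgn d"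
    unfolding A_def using assms
    by (cases "d < 0") (simp_all add: cnj_if_neg_def sphere_degree_cnj_fst sphere_degree_id)
  moreover have "sphere_degree B = sgn e"
    unfolding B_def using assms
    by (cases "e < 0") (simp_all add: cnj_if_neg_def sphere_degree_cnj_snd sphere_degree_id)
  moreover have "sphere_degree P = \<bar>d\<bar> * \<bar>e\<bar>"
    unfolding P_def using sphere_degree_power [of "nat \<bar>d\<bar>" "nat \<bar>e\<bar>"] assms by simp
  moreover have "(\<lambda>z. A (B (P z))) = (\<lambda>z. (cnj_if_neg d (fst z) ^ nat \<bar>d\<bar>, cnj_if_neg e (snd z) ^ nat \<bar>e\<bar>))"
    by (simp add: A_def B_def P_def cnj_if_neg_def fun_eq_iff)
  ultimately have "sphere_degree (\<lambda>z. (cnj_if_neg d (fst z) ^ nat \<bar>d\<bar>, cnj_if_neg e (snd z) ^ nat \<bar>e\<bar>))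
      = sgn d * (sgn e * (\<bar>d\<bar> * \<bar>e\<bar>))"
    by simp
  also have "\<dots> = (sgn d * \<bar>d\<bar>) * (sgn e * \<bar>e\<bar>)"
    by (simp only: ac_simps)
  finally show ?thesis
    by (simp add: sgn_mult_abs)
qed

text \<open>On the unit circle conjugation is inversion, so conjugate powers carry negative
  weights.\<close>

lemma cnj_if_neg_power_mult:
  assumes "norm c = 1"
  shows "cnj_if_neg d (c * z) ^ nat \<bar>d\<bar> = c powi d * cnj_if_neg d z ^ nat \<bar>d\<bar>"
proof -
  have "c * cnj c = 1"
    using complex_norm_square [of c] assms by simp
  then have "cnj c = inverse c"
    by (rule inverse_unique [symmetric])
  then show ?thesis
    by (simp add: cnj_if_neg_def power_int_def power_mult_distrib)
qed

text \<open>Only one equivariant model has to be computed. If a weight is 0, a constant map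
  supported on that coordinate is equivariant and has degree 0; otherwise the signed powers
  serve.\<close>

theorem sphere_degree_circle_equivariant_eq:
  assumes "continuous_on (sphere 0 1) s" "\<And>z. norm z = 1 \<Longrightarrow> s z \<noteq> 0" "circle_equivariant d e s"
  shows "sphere_degree s = d * e"
proof -
  note eq = sphere_degree_circle_equivariant [OF assms]
  consider "d = 0" | "e = 0" | "d \<noteq> 0" "e \<noteq> 0" by blast
  then show ?thesis
  proof cases
    case 1
    have "sphere_degree s = sphere_degree (\<lambda>z. (1, 0))"
      using 1 by (intro eq) (auto simp: circle_equivariant_def circle_act_def zero_prod_def)
    then show ?thesis
      using 1 by (simp add: sphere_degree_const)
  next
    case 2
    have "sphere_degree s = sphere_degree (\<lambda>z. (0, 1))"
      using 2 by (intro eq) (auto simp: circle_equivariant_def circle_act_def zero_prod_def)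
    then show ?thesis
      using 2 by (simp add: sphere_degree_const)
  next
    case 3
    have "sphere_degree s = sphere_degree (\<lambda>z. (cnj_if_neg d (fst z) ^ nat \<bar>d\<bar>, cnj_if_neg e (snd z) ^ nat \<bar>e\<bar>))"
    proof (rule eq)
      have cont: "continuous_on (sphere 0 1) (\<lambda>z. cnj_if_neg k (f z))" if "continuous_on (sphere 0 1) f"
        for k and f :: "complex \<times> complex \<Rightarrow> complex"
        unfolding cnj_if_neg_def using that by (cases "k < 0") (auto intro!: continuous_intros)
      show "continuous_on (sphere 0 1) (\<lambda>z. (cnj_if_neg d (fst z) ^ nat \<bar>d\<bar>, cnj_if_neg e (snd z) ^ nat \<bar>e\<bar>))"
        by (intro continuous_intros cont)
      have "cnj_if_neg k w = 0 \<longleftrightarrow> w = 0" for k w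
        by (simp add: cnj_if_neg_def)
      then show "(cnj_if_neg d (fst z) ^ nat \<bar>d\<bar>, cnj_if_neg e (snd z) ^ nat \<bar>e\<bar>) \<noteq> 0" if "norm z = 1" for z
        using norm_one_cases [OF that] by (auto simp: zero_prod_def)
      show "circle_equivariant d e (\<lambda>z. (cnj_if_neg d (fst z) ^ nat \<bar>d\<bar>, cnj_if_neg e (snd z) ^ nat \<bar>e\<bar>))"
        by (simp add: circle_equivariant_def circle_act_def cnj_if_neg_power_mult)
    qed
    then show ?thesis
      using 3 by (simp add: sphere_degree_signed_power)
  qed
qed

section \<open>Mixed polynomials\<close>

lemma mon_scale: "mon nu (k * x, k * y, k * z) = k ^ mdeg nu * mon nu (x, y, z)"
  by (cases nu) (simp add: power_mult_distrib power_add algebra_simps)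

text \<open>Common to real and unit scalars k: under either, all monomials of a strongly polar
  homogeneous polynomial pick up one factor w.\<close>

lemma mfun_scale:
  assumes "\<And>nu mu. c nu mu \<noteq> 0 \<Longrightarrow> k ^ mdeg nu * cnj k ^ mdeg mu = w"
  shows "mfun c (k * x, k * y, k * z) = w * mfun c (x, y, z)"
proof -
  have "c nu mu * mon nu (k * x, k * y, k * z) * mon mu (cnj k * cnj x, cnj k * cnj y, cnj k * cnj z)
      = w * (c nu mu * mon nu (x, y, z) * mon mu (cnj x, cnj y, cnj z))"
    if "c nu mu \<noteq> 0" for nu mu
    unfolding mon_scale assms [OF that, symmetric] by (simp only: ac_simps)
  then show ?thesis
    unfolding mfun_def meval_def conj3_def sum_distrib_left
    by (auto intro!: sum.cong simp del: mon.simps)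
qed

lemma mfun_scale_real:
  assumes "strongly_polar_homogeneous c n q"
  shows "mfun c (of_real t * x, of_real t * y, of_real t * z) = of_real t ^ n * mfun c (x, y, z)"
proof (rule mfun_scale)
  fix nu mu assume "c nu mu \<noteq> 0"
  then have "mdeg nu + mdeg mu = n"
    using assms unfolding strongly_polar_homogeneous_def by blast
  then show "of_real t ^ mdeg nu * cnj (of_real t) ^ mdeg mu = of_real t ^ n"
    by (simp add: power_add [symmetric])
qed

lemma mfun_scale_circle:
  assumes "strongly_polar_homogeneous c n q" "norm k = 1"
  shows "mfun c (k * x, k * y, k * z) = k powi q * mfun c (x, y, z)"
proof (rule mfun_scale)
  fix nu mu assume "c nu mu \<noteq> 0"
  then have "int (mdeg nu) - int (mdeg mu) = q"
    using assms(1) unfolding strongly_polar_homogeneous_def by blast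
  have "k \<noteq> 0"
    using assms(2) by auto
  have "k * cnj k = 1"
    using complex_norm_square [of k] assms(2) by simp
  then have "cnj k = inverse k"
    by (rule inverse_unique [symmetric])
  then show "k ^ mdeg nu * cnj k ^ mdeg mu = k powi q"
    using \<open>k \<noteq> 0\<close> \<open>int (mdeg nu) - int (mdeg mu) = q\<close> [symmetric]
    by (simp add: power_int_diff power_inverse divide_inverse)
qed

lemma continuous_on_mfun:
  assumes "continuous_on S a" "continuous_on S b" "continuous_on S e"
  shows "continuous_on S (\<lambda>x. mfun c (a x, b x, e x))"
proof -
  have mon: "continuous_on S (\<lambda>x. mon nu (a x, b x, e x))"
    if "continuous_on S a" "continuous_on S b" "continuous_on S e" for nu a b e
    using that by (cases nu) (auto intro!: continuous_intros)
  show ?thesis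
    unfolding mfun_def meval_def conj3_def case_prod_unfold fst_conv snd_conv
    using assms by (intro continuous_intros mon)
qed

section \<open>Local intersection numbers as sphere degrees\<close>

lemma dehom_0: "dehom c 0 z = mfun c (1, fst z, snd z)"
  by (cases z) (simp add: dehom_def mfun_def chart_pt_def conj3_def)

lemma normalize4_phi4: "normalize4 (phi4 f g z) = of_C2 (sgn (f z, g z))"
proof -
  have "to_C2 (phi4 f g z) = (f z, g z)"
    by (simp add: to_C2_def phi4_def)
  then have "sqrt (\<Sum>i\<le>3. phi4 f g z i ^ 2) = norm (f z, g z)"
    using norm_to_C2 [of "phi4 f g z"] by simp
  then have "normalize4 (phi4 f g z) = (\<lambda>k. phi4 f g z k / norm (f z, g z))"
    by (simp add: normalize4_def)
  then show ?thesis
    by (simp add: of_C2_def phi4_def sgn_Pair fun_eq_iff divide_inverse mult.commute)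
qed

lemma I_top_eq_sphere_degree:
  "I_top f g p = sphere_degree (\<lambda>z. (f (p + isol_radius f g p *\<^sub>R z), g (p + isol_radius f g p *\<^sub>R z)))"
  by (simp add: I_top_def sphere_degree_def Let_def normalize4_phi4)

text \<open>Finitely many zeros leave around any p a ball without further zeros, so the choice
  defining the radius is satisfiable.\<close>

lemma isol_radius:
  assumes "finite {z. f z = 0 \<and> g z = 0}"
  shows "isol_radius f g p > 0"
    and "f q = 0 \<Longrightarrow> g q = 0 \<Longrightarrow> dist p q \<le> isol_radius f g p \<Longrightarrow> q = p"
proof -
  have "\<exists>e. e > 0 \<and> (\<forall>q\<in>cball p e. f q = 0 \<and> g q = 0 \<longrightarrow> q = p)"
    using finite_isolated_radius [OF assms, of p]
    unfolding Ball_def mem_Collect_eq mem_cball by blast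
  from someI_ex [OF this]
  have "isol_radius f g p > 0 \<and> (\<forall>q\<in>cball p (isol_radius f g p). f q = 0 \<and> g q = 0 \<longrightarrow> q = p)"
    by (simp add: isol_radius_def)
  then show "isol_radius f g p > 0"
    and "f q = 0 \<Longrightarrow> g q = 0 \<Longrightarrow> dist p q \<le> isol_radius f g p \<Longrightarrow> q = p"
    by auto
qed

theorem theorem6:
  fixes F G :: "midx \<Rightarrow> midx \<Rightarrow> complex" and d d' :: int
  assumes F_sph: "\<exists>dr. strongly_polar_homogeneous F dr d"
    and G_sph: "\<exists>dr. strongly_polar_homogeneous G dr d'"
    and F_sing: "isolated_mixed_singularities F"
    and G_sing: "isolated_mixed_singularities G"
    and no_infinity: "\<forall>X1 X2. (X1, X2) \<noteq> (0, 0) \<longrightarrow>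
                         \<not> (mfun F (0, X1, X2) = 0 \<and> mfun G (0, X1, X2) = 0)"
    and fin: "finite {z. dehom F 0 z = 0 \<and> dehom G 0 z = 0}"
  shows "(\<Sum>P \<in> {z. dehom F 0 z = 0 \<and> dehom G 0 z = 0}. I_top (dehom F 0) (dehom G 0) P) = d * d'"
proof -
  obtain m n where m: "strongly_polar_homogeneous F m d" and n: "strongly_polar_homogeneous G n d'"
    using F_sph G_sph by blast
  define \<psi> where "\<psi> z = (dehom F 0 z, dehom G 0 z)" for z
  \<comment> \<open>Evaluates both forms at (t, z): t = 0 is the line at infinity, and for t > 0
    this is the affine map at z / t up to positive factors.\<close>
  define \<sigma> where "\<sigma> t z = (mfun F (of_real t, fst z, snd z), mfun G (of_real t, fst z, snd z))"
    for t :: real and z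
  have \<psi>0: "\<psi> z = 0 \<longleftrightarrow> dehom F 0 z = 0 \<and> dehom G 0 z = 0" for z
    by (simp add: \<psi>_def zero_prod_def)
  have finite_\<psi>: "finite {z. \<psi> z = 0}"
    using fin by (simp add: \<psi>0)
  obtain R where R: "R > 0" "\<And>z. \<psi> z = 0 \<Longrightarrow> norm z < R"
    using bounded_pos_less [of "{z. \<psi> z = 0}"] finite_imp_bounded [OF finite_\<psi>] by blast
  \<comment> \<open>At t = 0 this is the absence of intersections at infinity. For 0 < t \<le> 1 / R
    the point z / t has norm at least R, beyond all affine zeros.\<close>
  have \<sigma>_nz: "\<sigma> t z \<noteq> 0" if t: "0 \<le> t" "t \<le> 1 / R" and z: "norm z = 1" for t z
  proof (cases "t = 0")
    case True
    have "(fst z, snd z) \<noteq> (0, 0)"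
      using norm_one_cases [OF z] by auto
    then have "\<not> (mfun F (0, fst z, snd z) = 0 \<and> mfun G (0, fst z, snd z) = 0)"
      using no_infinity by blast
    then show ?thesis
      using True by (simp add: \<sigma>_def zero_prod_def)
  next
    case False
    have cancel: "of_real t * (w /\<^sub>R t) = w" for w :: complex
      using False by (simp add: scaleR_conv_of_real)
    have "\<sigma> t z = (of_real t ^ m * fst (\<psi> (z /\<^sub>R t)), of_real t ^ n * snd (\<psi> (z /\<^sub>R t)))"
      using mfun_scale_real [OF m, of t 1 "fst z /\<^sub>R t" "snd z /\<^sub>R t"]
        mfun_scale_real [OF n, of t 1 "fst z /\<^sub>R t" "snd z /\<^sub>R t"]
      by (simp add: cancel \<sigma>_def \<psi>_def dehom_0 del: mult_scaleR_right)
    moreover have "norm (z /\<^sub>R t) \<ge> R"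
      using t z False R(1) by (simp add: field_simps)
    then have "\<psi> (z /\<^sub>R t) \<noteq> 0"
      using R(2) [of "z /\<^sub>R t"] by linarith
    ultimately show ?thesis
      using False by (auto simp: prod_eq_iff)
  qed
  have \<sigma>_cont: "continuous_on S (\<lambda>x. \<sigma> (f x) (g x))"
    if "continuous_on S f" "continuous_on S g" for S and f :: "real \<times> complex \<times> complex \<Rightarrow> real" and g
    unfolding \<sigma>_def using that by (intro continuous_intros continuous_on_mfun)
  let ?r = "isol_radius (dehom F 0) (dehom G 0)"
  have "(\<Sum>P | \<psi> P = 0. sphere_degree (\<lambda>z. \<psi> (P + ?r P *\<^sub>R z))) = sphere_degree (\<lambda>z. \<psi> (R *\<^sub>R z))"
  proof (rule sphere_degree_eq_sum [symmetric])
    show "continuous_on UNIV \<psi>"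
      unfolding \<psi>_def dehom_0 by (intro continuous_intros continuous_on_mfun)
    show "?r P > 0" for P
      by (rule isol_radius [OF fin])
    show "Q = P" if "\<psi> Q = 0" "dist P Q \<le> ?r P" for P Q
      using isol_radius(2) [OF fin] that by (simp add: \<psi>0)
  qed (use R finite_\<psi> in auto)
  \<comment> \<open>Radial homogeneity extracts R from (1, R z) = R (1 / R, z).\<close>
  also have "\<dots> = sphere_degree (\<lambda>z. (of_real R ^ m * mfun F (of_real (1 / R), fst z, snd z),
      of_real R ^ n * mfun G (of_real (1 / R), fst z, snd z)))"
    using mfun_scale_real [OF m, of R "of_real (1 / R)"] mfun_scale_real [OF n, of R "of_real (1 / R)"] R(1)
    by (simp add: \<psi>_def dehom_0 scaleR_conv_of_real)
  also have "\<dots> = sphere_degree (\<sigma> (1 / R))"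
    unfolding \<sigma>_def
  proof (rule sphere_degree_scale_components)
    show "continuous_on (sphere 0 1) (\<lambda>z. mfun F (of_real (1 / R), fst z, snd z))"
      "continuous_on (sphere 0 1) (\<lambda>z. mfun G (of_real (1 / R), fst z, snd z))"
      by (intro continuous_intros continuous_on_mfun)+
    fix z :: "complex \<times> complex" assume "norm z = 1"
    then show "mfun F (of_real (1 / R), fst z, snd z) \<noteq> 0 \<or> mfun G (of_real (1 / R), fst z, snd z) \<noteq> 0"
      using \<sigma>_nz [of "1 / R" z] R(1) by (auto simp: \<sigma>_def zero_prod_def)
  qed (use R(1) in auto)
  \<comment> \<open>Pushes the sphere to infinity by lowering t from 1 / R to 0.\<close>
  also have "\<dots> = sphere_degree (\<sigma> 0)"
  proof (rule sphere_degree_homotopic [of "\<lambda>x. \<sigma> ((1 - fst x) / R) (snd x)"])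
    show "continuous_on ({0..1} \<times> sphere 0 1) (\<lambda>x. \<sigma> ((1 - fst x) / R) (snd x))"
      using R(1) by (intro \<sigma>_cont continuous_intros) auto
    show "\<sigma> ((1 - fst (t, z)) / R) (snd (t, z)) \<noteq> 0" if "0 \<le> t" "t \<le> 1" "norm z = 1" for t and z :: "complex \<times> complex"
      using that R(1) by (intro \<sigma>_nz) (auto simp: divide_right_mono)
  qed auto
  also have "\<dots> = d * d'"
  proof (rule sphere_degree_circle_equivariant_eq)
    show "continuous_on (sphere 0 1) (\<sigma> 0)"
      unfolding \<sigma>_def by (intro continuous_intros continuous_on_mfun)
    show "\<sigma> 0 z \<noteq> 0" if "norm z = 1" for z
      using that R(1) by (intro \<sigma>_nz) auto
    \<comment> \<open>Multiplication by a unit scalar fixes the vanishing first coordinate, so polar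
      homogeneity becomes equivariance in z alone.\<close>
    show "circle_equivariant d d' (\<sigma> 0)"
      using mfun_scale_circle [OF m, of _ 0] mfun_scale_circle [OF n, of _ 0]
      by (simp add: circle_equivariant_def circle_act_def \<sigma>_def)
  qed
  finally show ?thesis
    by (simp add: I_top_eq_sphere_degree \<psi>_def zero_prod_def)
qed

end
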